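(* Let $\mathcal S$ be a class of Künneth cohomologies on $(\mathcal C,\times,1)$. The following are equivalent: (1) all $H\in\mathcal S$ are $\kappa$-equivalent to one another; (2) every $H\in\mathcal S$ is a realisation of $U_{\kappa,\mathcal S}$ along $r_{\kappa,H}$; (3) for every $H\in\mathcal S$ the canonical functor $\mathcal A_{\kappa,\mathcal S}(\mathcal C)\to\mathcal A_\kappa(H)$ is an equivalence. Likewise, in the relative case, let $\mathcal S$ be a class of relative Künneth cohomologies on $(\mathcal C^\square,\times,(1,\emptyset))$. The following are equivalent: (1') all $H\in\mathcal S$ are $\partial\kappa$-equivalent to one another; (2') every $H\in\mathcal S$ is a realisation of $U_{\partial\kappa,\mathcal S}$ along $r_{\partial\kappa,H}$; (3') for every $H\in\mathcal S$ the canonical functor $\mathcal A_{\partial\kappa,\mathcal S}(\mathcal C)\to\mathcal A_{\partial\kappa}(H)$ is an equivalence.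
   Context: Size issues are handled as usual by universes. "Tensor structure" means unital symmetric monoidal structure; $(\mathcal C,\times,1)$ is a category with tensor structure given by products and a final object $1$. $\mathrm{Ex}^\otimes$ is the 2-category of abelian tensor $\mathbb Q$-linear categories $(\mathcal A,\otimes,\mathbb 1)$ with $\otimes$ exact, and exact strong tensor $\mathbb Q$-linear functors. Künneth cohomology. A Künneth cohomology on $\mathcal C$ with values in $\mathcal A\in\mathrm{Ex}^\otimes$ is a triple $(H,\kappa,\upsilon)$ where $H=\{H^i\}_{i\in\mathbb N}$ is a family of contravariant functors $H^i:\mathcal C\to\mathcal A$; $\kappa^{i,j}_{X,Y}:H^i(X)\otimes H^j(Y)\to H^{i+j}(X\times Y)$ are natural, associative, unital and graded commutative; $H^i(1)=0$ for $i\neq0$ and $\upsilon:H^0(1)\cong\mathbb 1$; and $\sum\kappa^{i,j}_{X,Y}:\bigoplus_{i+j=k}H^i(X)\otimes H^j(Y)\to H^k(X\times Y)$ is an isomorphism for all $k$. Equivalently, $H^*:\mathcal C\to\mathcal A^{\mathbb N}$ is a contravariant strong tensor functor ($\mathcal A^{\mathbb N}$ with the Koszul symmetry). Relative Künneth cohomology. $\mathcal C^\square$ is a category of pairs $(X,Y)$, $X\in\mathcal C$, $Y$ a (closed, distinguished) subobject of $X$, with the needed unions, intersections and products available, and tensor structure $(X,Y)\times(X',Y'):=(X\times X',X\times Y'\cup Y\times X')$ with unit $(1,\emptyset)$. A relative Künneth cohomology with values in $\mathcal A$ consists of contravariant functors $H^i:\mathcal C^\square\to\mathcal A$ ($i\in\mathbb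 N$), boundary morphisms $\partial^i:H^i(Y,Z)\to H^{i+1}(X,Y)$ for $(X,Y),(Y,Z)\in\mathcal C^\square$ natural in triples, natural associative unital graded commutative external products $\kappa^{i,j}:H^i(X,Y)\otimes H^j(X',Y')\to H^{i+j}(X\times X',X\times Y'\cup Y\times X')$, and $\upsilon:H^0(1,\emptyset)\cong\mathbb 1$ with $H^i(1,\emptyset)=0$ for $i\ne0$, such that triples give long exact sequences, excision holds ($H^i(X,Z)\cong H^i(Y,Y\cap Z)$ if $X=Y\cup Z$), the relative Künneth maps $\sum\kappa^{i,j}$ are isomorphisms, and $\kappa$ is compatible with $\partial$ (i.e. $\kappa\circ(\partial\otimes\mathrm{id})$ on $H^i(Y,\emptyset)\otimes H^j(X',Y')$ is $\kappa$ into $H^{i+j}(Y\times X',Y\times Y')$ followed by inverse excision to $H^{i+j}(X\times Y'\cup Y\times X',X\times Y')$ and the boundary). Universal theories. There is a universal Künneth cohomology $U_\kappa$ with values in $\mathcal A_\kappa(\mathcal C)\in\mathrm{Ex}^\otimes$, and a universal relative Künneth cohomology $U_{\partial\kappa}$ with values in $\mathcal A_{\partial\kappa}(\mathcal C)\in\mathrm{Ex}^\otimes$: every (relative) Künneth cohomology $H$ with values in $\mathcal A$ is the push-forward of $U_\kappa$ (resp. $U_{\partial\kappa}$) along an exact strong tensor $\mathbb Q$-linear functor $F_H^\kappa:\mathcal A_\kappa(\mathcal C)\to\mathcal A$ (resp. $F_H^{\partial\kappa}:\mathcal A_{\partial\kappa}(\mathcal C)\to\mathcal A$), unique up to isomorphism.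 $\mathrm{Ker}$ of an exact tensor functor (objects sent to $0$) is a Serre tensor ideal, and Serre quotients by Serre tensor ideals inherit exact tensor structures. Put $\mathcal A_\kappa(H):=\mathcal A_\kappa(\mathcal C)/\mathrm{Ker}\,F_H^\kappa$ and, for $H$ relative, $\mathcal A_{\partial\kappa}(H):=\mathcal A_{\partial\kappa}(\mathcal C)/\mathrm{Ker}\,F_H^{\partial\kappa}$. $H,H'$ are $\kappa$-equivalent (resp. $\partial\kappa$-equivalent) if there is a tensor equivalence $\mathcal A_\kappa(H)\cong\mathcal A_\kappa(H')$ under $\mathcal A_\kappa(\mathcal C)$, i.e. $\mathrm{Ker}\,F_H^\kappa=\mathrm{Ker}\,F_{H'}^\kappa$ (resp. $\mathcal A_{\partial\kappa}(H)\cong\mathcal A_{\partial\kappa}(H')$ under $\mathcal A_{\partial\kappa}(\mathcal C)$, i.e. $\mathrm{Ker}\,F_H^{\partial\kappa}=\mathrm{Ker}\,F_{H'}^{\partial\kappa}$). For a class $\mathcal S$: $\mathcal A_{\kappa,\mathcal S}(\mathcal C):=\mathcal A_\kappa(\mathcal C)/\bigcap_{H\in\mathcal S}\mathrm{Ker}\,F_H^\kappa$; $U_{\kappa,\mathcal S}$ is the push-forward of $U_\kappa$ along the projection; $r_{\kappa,H}:\mathcal A_{\kappa,\mathcal S}(\mathcal C)\to\mathcal A$ is the exact tensor functor induced by $F_H^\kappa$, so $H=(r_{\kappa,H})_*U_{\kappa,\mathcal S}$; there is a canonical quotient functor $\mathcal A_{\kappa,\mathcal S}(\mathcal C)\to\mathcal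 A_\kappa(H)$. Similarly for $\mathcal A_{\partial\kappa,\mathcal S}(\mathcal C)$, $U_{\partial\kappa,\mathcal S}$, $r_{\partial\kappa,H}$ with $\partial\kappa$ in place of $\kappa$. "$H$ is a realisation of $U_{\kappa,\mathcal S}$ along $r_{\kappa,H}$" means that $r_{\kappa,H}$ is faithful (and exact tensor) with $H=(r_{\kappa,H})_*U_{\kappa,\mathcal S}$; similarly in the relative case. *)

theory Defs
  imports Complex_Main
begin

section \<open>Categories\<close>

record ('o, 'm) cat =
  Obj :: "'o set"
  Arr :: "'m set"
  Dom :: "'m \<Rightarrow> 'o"
  Cod :: "'m \<Rightarrow> 'o"
  Ide :: "'o \<Rightarrow> 'm"
  Cmp :: "'m \<Rightarrow> 'm \<Rightarrow> 'm"  (infixr "\<cdot>\<index>" 60)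

definition Hom :: "('o, 'm, 'z) cat_scheme \<Rightarrow> 'o \<Rightarrow> 'o \<Rightarrow> 'm set" where
  "Hom C X Y = {f \<in> Arr C. Dom C f = X \<and> Cod C f = Y}"

locale category =
  fixes C :: "('o, 'm, 'z) cat_scheme" (structure)
  assumes dom_in: "f \<in> Arr C \<Longrightarrow> Dom C f \<in> Obj C"
    and cod_in: "f \<in> Arr C \<Longrightarrow> Cod C f \<in> Obj C"
    and ide_in: "X \<in> Obj C \<Longrightarrow> Ide C X \<in> Hom C X X"
    and cmp_in: "f \<in> Hom C X Y \<Longrightarrow> g \<in> Hom C Y Z \<Longrightarrow> g \<cdot> f \<in> Hom C X Z"
    and cmp_ide: "f \<in> Hom C X Y \<Longrightarrow> f \<cdot> Ide C X = f"
    and ide_cmp: "f \<in> Hom C X Y \<Longrightarrow> Ide C Y \<cdot> f = f"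
    and cmp_assoc: "f \<in> Hom C W X \<Longrightarrow> g \<in> Hom C X Y \<Longrightarrow> h \<in> Hom C Y Z \<Longrightarrow>
                    (h \<cdot> g) \<cdot> f = h \<cdot> (g \<cdot> f)"

definition is_inverse :: "('o, 'm, 'z) cat_scheme \<Rightarrow> 'm \<Rightarrow> 'm \<Rightarrow> bool" where
  "is_inverse C f g \<longleftrightarrow> f \<in> Arr C \<and> g \<in> Hom C (Cod C f) (Dom C f) \<and>
     g \<cdot>\<^bsub>C\<^esub> f = Ide C (Dom C f) \<and> f \<cdot>\<^bsub>C\<^esub> g = Ide C (Cod C f)"

definition is_iso :: "('o, 'm, 'z) cat_scheme \<Rightarrow> 'm \<Rightarrow> bool" where
  "is_iso C f \<longleftrightarrow> (\<exists>g. is_inverse C f g)"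

definition inv_arr :: "('o, 'm, 'z) cat_scheme \<Rightarrow> 'm \<Rightarrow> 'm" where
  "inv_arr C f = (THE g. is_inverse C f g)"

definition monic :: "('o, 'm, 'z) cat_scheme \<Rightarrow> 'm \<Rightarrow> bool" where
  "monic C f \<longleftrightarrow> f \<in> Arr C \<and>
     (\<forall>W. \<forall>g \<in> Hom C W (Dom C f). \<forall>h \<in> Hom C W (Dom C f). f \<cdot>\<^bsub>C\<^esub> g = f \<cdot>\<^bsub>C\<^esub> h \<longrightarrow> g = h)"

definition epic :: "('o, 'm, 'z) cat_scheme \<Rightarrow> 'm \<Rightarrow> bool" where
  "epic C f \<longleftrightarrow> f \<in> Arr C \<and>
     (\<forall>Z. \<forall>g \<in> Hom C (Cod C f) Z. \<forall>h \<in> Hom C (Cod C f) Z. g \<cdot>\<^bsub>C\<^esub> f = h \<cdot>\<^bsub>C\<^esub> f \<longrightarrow> g = h)"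

definition is_initial :: "('o, 'm, 'z) cat_scheme \<Rightarrow> 'o \<Rightarrow> bool" where
  "is_initial C Z \<longleftrightarrow> Z \<in> Obj C \<and> (\<forall>X \<in> Obj C. \<exists>!f. f \<in> Hom C Z X)"

definition is_terminal :: "('o, 'm, 'z) cat_scheme \<Rightarrow> 'o \<Rightarrow> bool" where
  "is_terminal C Z \<longleftrightarrow> Z \<in> Obj C \<and> (\<forall>X \<in> Obj C. \<exists>!f. f \<in> Hom C X Z)"

definition is_zero :: "('o, 'm, 'z) cat_scheme \<Rightarrow> 'o \<Rightarrow> bool" where
  "is_zero C Z \<longleftrightarrow> is_initial C Z \<and> is_terminal C Z"

definition is_pullback :: "('o, 'm, 'z) cat_scheme \<Rightarrow> 'm \<Rightarrow> 'm \<Rightarrow> 'm \<Rightarrow> 'm \<Rightarrow> bool" where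
  "is_pullback C i j p q \<longleftrightarrow>
     i \<in> Arr C \<and> j \<in> Arr C \<and> Cod C i = Cod C j \<and>
     p \<in> Hom C (Dom C p) (Dom C i) \<and> q \<in> Hom C (Dom C p) (Dom C j) \<and> i \<cdot>\<^bsub>C\<^esub> p = j \<cdot>\<^bsub>C\<^esub> q \<and>
     (\<forall>W. \<forall>f \<in> Hom C W (Dom C i). \<forall>g \<in> Hom C W (Dom C j). i \<cdot>\<^bsub>C\<^esub> f = j \<cdot>\<^bsub>C\<^esub> g \<longrightarrow>
        (\<exists>!h. h \<in> Hom C W (Dom C p) \<and> p \<cdot>\<^bsub>C\<^esub> h = f \<and> q \<cdot>\<^bsub>C\<^esub> h = g))"

definition is_coproduct ::
  "('o, 'm, 'z) cat_scheme \<Rightarrow> 'i set \<Rightarrow> ('i \<Rightarrow> 'o) \<Rightarrow> 'o \<Rightarrow> ('i \<Rightarrow> 'm) \<Rightarrow> bool" where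
  "is_coproduct C I V S \<iota> \<longleftrightarrow> S \<in> Obj C \<and> (\<forall>i \<in> I. \<iota> i \<in> Hom C (V i) S) \<and>
     (\<forall>W \<in> Obj C. \<forall>f. (\<forall>i \<in> I. f i \<in> Hom C (V i) W) \<longrightarrow>
        (\<exists>!h. h \<in> Hom C S W \<and> (\<forall>i \<in> I. h \<cdot>\<^bsub>C\<^esub> \<iota> i = f i)))"


section \<open>Tensor categories\<close>

text \<open>A tensor structure is a unital symmetric monoidal structure.  The structure
  isomorphisms are \<open>Asc X Y Z : (X \<odot> Y) \<odot> Z \<rightarrow> X \<odot> (Y \<odot> Z)\<close>,
  \<open>LUn X : 1 \<odot> X \<rightarrow> X\<close>, \<open>RUn X : X \<odot> 1 \<rightarrow> X\<close> and \<open>Brd X Y : X \<odot> Y \<rightarrow> Y \<odot> X\<close>.\<close>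

record ('o, 'm) tcat = "('o, 'm) cat" +
  TenO :: "'o \<Rightarrow> 'o \<Rightarrow> 'o"  (infixr "\<odot>\<index>" 70)
  TenA :: "'m \<Rightarrow> 'm \<Rightarrow> 'm"  (infixr "\<otimes>\<index>" 70)
  Unit :: "'o"
  Asc :: "'o \<Rightarrow> 'o \<Rightarrow> 'o \<Rightarrow> 'm"
  LUn :: "'o \<Rightarrow> 'm"
  RUn :: "'o \<Rightarrow> 'm"
  Brd :: "'o \<Rightarrow> 'o \<Rightarrow> 'm"

locale tensor_category = category C for C :: "('o, 'm, 'z) tcat_scheme" (structure) +
  assumes unit_in: "Unit C \<in> Obj C"
    and tenO_in: "X \<in> Obj C \<Longrightarrow> Y \<in> Obj C \<Longrightarrow> X \<odot> Y \<in> Obj C"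
    and tenA_in: "f \<in> Hom C X X' \<Longrightarrow> g \<in> Hom C Y Y' \<Longrightarrow> f \<otimes> g \<in> Hom C (X \<odot> Y) (X' \<odot> Y')"
    and ten_ide: "X \<in> Obj C \<Longrightarrow> Y \<in> Obj C \<Longrightarrow> Ide C X \<otimes> Ide C Y = Ide C (X \<odot> Y)"
    and ten_cmp: "f \<in> Hom C X X' \<Longrightarrow> f' \<in> Hom C X' X'' \<Longrightarrow> g \<in> Hom C Y Y' \<Longrightarrow> g' \<in> Hom C Y' Y'' \<Longrightarrow>
                  (f' \<cdot> f) \<otimes> (g' \<cdot> g) = (f' \<otimes> g') \<cdot> (f \<otimes> g)"
    and asc_in: "X \<in> Obj C \<Longrightarrow> Y \<in> Obj C \<Longrightarrow> Z \<in> Obj C \<Longrightarrow>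
                 Asc C X Y Z \<in> Hom C ((X \<odot> Y) \<odot> Z) (X \<odot> (Y \<odot> Z)) \<and> is_iso C (Asc C X Y Z)"
    and lun_in: "X \<in> Obj C \<Longrightarrow> LUn C X \<in> Hom C (Unit C \<odot> X) X \<and> is_iso C (LUn C X)"
    and run_in: "X \<in> Obj C \<Longrightarrow> RUn C X \<in> Hom C (X \<odot> Unit C) X \<and> is_iso C (RUn C X)"
    and brd_in: "X \<in> Obj C \<Longrightarrow> Y \<in> Obj C \<Longrightarrow> Brd C X Y \<in> Hom C (X \<odot> Y) (Y \<odot> X)"
    and asc_nat: "f \<in> Hom C X X' \<Longrightarrow> g \<in> Hom C Y Y' \<Longrightarrow> h \<in> Hom C Z Z' \<Longrightarrow>
                  Asc C X' Y' Z' \<cdot> ((f \<otimes> g) \<otimes> h) = (f \<otimes> (g \<otimes> h)) \<cdot> Asc C X Y Z"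
    and lun_nat: "f \<in> Hom C X X' \<Longrightarrow> LUn C X' \<cdot> (Ide C (Unit C) \<otimes> f) = f \<cdot> LUn C X"
    and run_nat: "f \<in> Hom C X X' \<Longrightarrow> RUn C X' \<cdot> (f \<otimes> Ide C (Unit C)) = f \<cdot> RUn C X"
    and brd_nat: "f \<in> Hom C X X' \<Longrightarrow> g \<in> Hom C Y Y' \<Longrightarrow>
                  Brd C X' Y' \<cdot> (f \<otimes> g) = (g \<otimes> f) \<cdot> Brd C X Y"
    and pentagon: "W \<in> Obj C \<Longrightarrow> X \<in> Obj C \<Longrightarrow> Y \<in> Obj C \<Longrightarrow> Z \<in> Obj C \<Longrightarrow>
       Asc C W X (Y \<odot> Z) \<cdot> Asc C (W \<odot> X) Y Z =
       (Ide C W \<otimes> Asc C X Y Z) \<cdot> (Asc C W (X \<odot> Y) Z \<cdot> (Asc C W X Y \<otimes> Ide C Z))"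
    and triangle: "X \<in> Obj C \<Longrightarrow> Y \<in> Obj C \<Longrightarrow>
       (Ide C X \<otimes> LUn C Y) \<cdot> Asc C X (Unit C) Y = RUn C X \<otimes> Ide C Y"
    and hexagon: "X \<in> Obj C \<Longrightarrow> Y \<in> Obj C \<Longrightarrow> Z \<in> Obj C \<Longrightarrow>
       Asc C Y Z X \<cdot> (Brd C X (Y \<odot> Z) \<cdot> Asc C X Y Z) =
       (Ide C Y \<otimes> Brd C X Z) \<cdot> (Asc C Y X Z \<cdot> (Brd C X Y \<otimes> Ide C Z))"
    and symmetry: "X \<in> Obj C \<Longrightarrow> Y \<in> Obj C \<Longrightarrow> Brd C Y X \<cdot> Brd C X Y = Ide C (X \<odot> Y)"

definition to_unit :: "('o, 'm, 'z) tcat_scheme \<Rightarrow> 'o \<Rightarrow> 'm" where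
  "to_unit C X = (THE f. f \<in> Hom C X (Unit C))"

definition pr1 :: "('o, 'm, 'z) tcat_scheme \<Rightarrow> 'o \<Rightarrow> 'o \<Rightarrow> 'm" where
  "pr1 C X Y = RUn C X \<cdot>\<^bsub>C\<^esub> (Ide C X \<otimes>\<^bsub>C\<^esub> to_unit C Y)"

definition pr2 :: "('o, 'm, 'z) tcat_scheme \<Rightarrow> 'o \<Rightarrow> 'o \<Rightarrow> 'm" where
  "pr2 C X Y = LUn C Y \<cdot>\<^bsub>C\<^esub> (to_unit C X \<otimes>\<^bsub>C\<^esub> Ide C Y)"

text \<open>The tensor structure is the one given by products and a final object.  Being compatible
  with the projections, the structure isomorphisms are then forced to be the canonical ones.\<close>

locale cartesian_category = tensor_category C for C :: "('o, 'm, 'z) tcat_scheme" (structure) +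
  assumes unit_terminal: "is_terminal C (Unit C)"
    and product: "f \<in> Hom C Z X \<Longrightarrow> g \<in> Hom C Z Y \<Longrightarrow>
       \<exists>!h. h \<in> Hom C Z (X \<odot> Y) \<and> pr1 C X Y \<cdot> h = f \<and> pr2 C X Y \<cdot> h = g"


section \<open>Abelian tensor categories over the rationals with exact tensor product\<close>

record ('o, 'm) lcat = "('o, 'm) tcat" +
  Add :: "'m \<Rightarrow> 'm \<Rightarrow> 'm"  (infixl "\<oplus>\<index>" 55)
  Zer :: "'o \<Rightarrow> 'o \<Rightarrow> 'm"
  Scl :: "rat \<Rightarrow> 'm \<Rightarrow> 'm"

locale linear_category = category C for C :: "('o, 'm, 'z) lcat_scheme" (structure) +
  assumes zer_in: "X \<in> Obj C \<Longrightarrow> Y \<in> Obj C \<Longrightarrow> Zer C X Y \<in> Hom C X Y"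
    and add_in: "f \<in> Hom C X Y \<Longrightarrow> g \<in> Hom C X Y \<Longrightarrow> f \<oplus> g \<in> Hom C X Y"
    and scl_in: "f \<in> Hom C X Y \<Longrightarrow> Scl C a f \<in> Hom C X Y"
    and add_assoc: "f \<in> Hom C X Y \<Longrightarrow> g \<in> Hom C X Y \<Longrightarrow> h \<in> Hom C X Y \<Longrightarrow> (f \<oplus> g) \<oplus> h = f \<oplus> (g \<oplus> h)"
    and add_comm: "f \<in> Hom C X Y \<Longrightarrow> g \<in> Hom C X Y \<Longrightarrow> f \<oplus> g = g \<oplus> f"
    and add_zer: "f \<in> Hom C X Y \<Longrightarrow> f \<oplus> Zer C X Y = f"
    and add_neg: "f \<in> Hom C X Y \<Longrightarrow> \<exists>g \<in> Hom C X Y. f \<oplus> g = Zer C X Y"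
    and scl_one: "f \<in> Hom C X Y \<Longrightarrow> Scl C 1 f = f"
    and scl_scl: "f \<in> Hom C X Y \<Longrightarrow> Scl C a (Scl C b f) = Scl C (a * b) f"
    and scl_left: "f \<in> Hom C X Y \<Longrightarrow> Scl C (a + b) f = Scl C a f \<oplus> Scl C b f"
    and scl_right: "f \<in> Hom C X Y \<Longrightarrow> g \<in> Hom C X Y \<Longrightarrow> Scl C a (f \<oplus> g) = Scl C a f \<oplus> Scl C a g"
    and cmp_add_left: "f \<in> Hom C X Y \<Longrightarrow> g \<in> Hom C Y Z \<Longrightarrow> g' \<in> Hom C Y Z \<Longrightarrow>
                       (g \<oplus> g') \<cdot> f = (g \<cdot> f) \<oplus> (g' \<cdot> f)"
    and cmp_add_right: "f \<in> Hom C X Y \<Longrightarrow> f' \<in> Hom C X Y \<Longrightarrow> g \<in> Hom C Y Z \<Longrightarrow>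
                        g \<cdot> (f \<oplus> f') = (g \<cdot> f) \<oplus> (g \<cdot> f')"
    and cmp_scl_left: "f \<in> Hom C X Y \<Longrightarrow> g \<in> Hom C Y Z \<Longrightarrow> Scl C a g \<cdot> f = Scl C a (g \<cdot> f)"
    and cmp_scl_right: "f \<in> Hom C X Y \<Longrightarrow> g \<in> Hom C Y Z \<Longrightarrow> g \<cdot> Scl C a f = Scl C a (g \<cdot> f)"

definition is_kernel :: "('o, 'm, 'z) lcat_scheme \<Rightarrow> 'm \<Rightarrow> 'm \<Rightarrow> bool" where
  "is_kernel C f k \<longleftrightarrow> f \<in> Arr C \<and> k \<in> Hom C (Dom C k) (Dom C f) \<and>
     f \<cdot>\<^bsub>C\<^esub> k = Zer C (Dom C k) (Cod C f) \<and>
     (\<forall>W. \<forall>h \<in> Hom C W (Dom C f). f \<cdot>\<^bsub>C\<^esub> h = Zer C W (Cod C f) \<longrightarrow>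
        (\<exists>!u. u \<in> Hom C W (Dom C k) \<and> k \<cdot>\<^bsub>C\<^esub> u = h))"

definition is_cokernel :: "('o, 'm, 'z) lcat_scheme \<Rightarrow> 'm \<Rightarrow> 'm \<Rightarrow> bool" where
  "is_cokernel C f c \<longleftrightarrow> f \<in> Arr C \<and> c \<in> Hom C (Cod C f) (Cod C c) \<and>
     c \<cdot>\<^bsub>C\<^esub> f = Zer C (Dom C f) (Cod C c) \<and>
     (\<forall>W. \<forall>h \<in> Hom C (Cod C f) W. h \<cdot>\<^bsub>C\<^esub> f = Zer C (Dom C f) W \<longrightarrow>
        (\<exists>!u. u \<in> Hom C (Cod C c) W \<and> u \<cdot>\<^bsub>C\<^esub> c = h))"

locale abelian_category = linear_category C for C :: "('o, 'm, 'z) lcat_scheme" (structure) +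
  assumes zero_object: "\<exists>Z. is_zero C Z"
    and biproduct: "X \<in> Obj C \<Longrightarrow> Y \<in> Obj C \<Longrightarrow>
       \<exists>S. \<exists>i \<in> Hom C X S. \<exists>j \<in> Hom C Y S. \<exists>p \<in> Hom C S X. \<exists>q \<in> Hom C S Y.
         p \<cdot> i = Ide C X \<and> q \<cdot> j = Ide C Y \<and> q \<cdot> i = Zer C X Y \<and> p \<cdot> j = Zer C Y X \<and>
         (i \<cdot> p) \<oplus> (j \<cdot> q) = Ide C S"
    and kernel: "f \<in> Arr C \<Longrightarrow> \<exists>k. is_kernel C f k"
    and cokernel: "f \<in> Arr C \<Longrightarrow> \<exists>c. is_cokernel C f c"
    and monic_normal: "monic C f \<Longrightarrow> \<exists>g. is_kernel C g f"
    and epic_normal: "epic C f \<Longrightarrow> \<exists>g. is_cokernel C g f"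

definition exact_at :: "('o, 'm, 'z) lcat_scheme \<Rightarrow> 'm \<Rightarrow> 'm \<Rightarrow> bool" where
  "exact_at C f g \<longleftrightarrow> (\<exists>k e. is_kernel C g k \<and> e \<in> Hom C (Dom C f) (Dom C k) \<and>
     f \<in> Hom C (Dom C f) (Dom C g) \<and> k \<cdot>\<^bsub>C\<^esub> e = f \<and> epic C e)"

definition short_exact :: "('o, 'm, 'z) lcat_scheme \<Rightarrow> 'm \<Rightarrow> 'm \<Rightarrow> bool" where
  "short_exact C f g \<longleftrightarrow> is_kernel C g f \<and> is_cokernel C f g"

text \<open>The objects of the 2-category \<open>Ex\<^sup>\<otimes>\<close>.\<close>

locale ex_tensor_category = tensor_category C + abelian_category C
  for C :: "('o, 'm, 'z) lcat_scheme" (structure) +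
  assumes ten_add_left: "f \<in> Hom C X X' \<Longrightarrow> f' \<in> Hom C X X' \<Longrightarrow> g \<in> Hom C Y Y' \<Longrightarrow>
                         (f \<oplus> f') \<otimes> g = (f \<otimes> g) \<oplus> (f' \<otimes> g)"
    and ten_add_right: "f \<in> Hom C X X' \<Longrightarrow> g \<in> Hom C Y Y' \<Longrightarrow> g' \<in> Hom C Y Y' \<Longrightarrow>
                        f \<otimes> (g \<oplus> g') = (f \<otimes> g) \<oplus> (f \<otimes> g')"
    and ten_scl_left: "f \<in> Hom C X X' \<Longrightarrow> g \<in> Hom C Y Y' \<Longrightarrow> Scl C a f \<otimes> g = Scl C a (f \<otimes> g)"
    and ten_scl_right: "f \<in> Hom C X X' \<Longrightarrow> g \<in> Hom C Y Y' \<Longrightarrow> f \<otimes> Scl C a g = Scl C a (f \<otimes> g)"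
    and ten_kernel_left: "X \<in> Obj C \<Longrightarrow> is_kernel C f k \<Longrightarrow> is_kernel C (Ide C X \<otimes> f) (Ide C X \<otimes> k)"
    and ten_kernel_right: "X \<in> Obj C \<Longrightarrow> is_kernel C f k \<Longrightarrow> is_kernel C (f \<otimes> Ide C X) (k \<otimes> Ide C X)"
    and ten_cokernel_left: "X \<in> Obj C \<Longrightarrow> is_cokernel C f c \<Longrightarrow> is_cokernel C (Ide C X \<otimes> f) (Ide C X \<otimes> c)"
    and ten_cokernel_right: "X \<in> Obj C \<Longrightarrow> is_cokernel C f c \<Longrightarrow> is_cokernel C (f \<otimes> Ide C X) (c \<otimes> Ide C X)"


section \<open>Functors\<close>

record ('a, 'b, 'o, 'm) fctr =
  FO :: "'a \<Rightarrow> 'o"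
  FA :: "'b \<Rightarrow> 'm"

locale is_functor = A: category A + B: category B
  for A :: "('a, 'b, 'y) cat_scheme" and B :: "('o, 'm, 'z) cat_scheme" +
  fixes F :: "('a, 'b, 'o, 'm, 'x) fctr_scheme"
  assumes fo_in: "X \<in> Obj A \<Longrightarrow> FO F X \<in> Obj B"
    and fa_in: "f \<in> Hom A X Y \<Longrightarrow> FA F f \<in> Hom B (FO F X) (FO F Y)"
    and fa_ide: "X \<in> Obj A \<Longrightarrow> FA F (Ide A X) = Ide B (FO F X)"
    and fa_cmp: "f \<in> Hom A X Y \<Longrightarrow> g \<in> Hom A Y Z \<Longrightarrow> FA F (g \<cdot>\<^bsub>A\<^esub> f) = FA F g \<cdot>\<^bsub>B\<^esub> FA F f"

definition faithful :: "('a, 'b, 'y) cat_scheme \<Rightarrow> ('a, 'b, 'o, 'm, 'x) fctr_scheme \<Rightarrow> bool" where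
  "faithful A F \<longleftrightarrow> (\<forall>X Y. inj_on (FA F) (Hom A X Y))"

definition natural_iso ::
  "('a, 'b, 'y) cat_scheme \<Rightarrow> ('o, 'm, 'z) cat_scheme \<Rightarrow>
   ('a, 'b, 'o, 'm, 'w) fctr_scheme \<Rightarrow> ('a, 'b, 'o, 'm, 'x) fctr_scheme \<Rightarrow> ('a \<Rightarrow> 'm) \<Rightarrow> bool" where
  "natural_iso A B F G \<theta> \<longleftrightarrow>
     (\<forall>X \<in> Obj A. \<theta> X \<in> Hom B (FO F X) (FO G X) \<and> is_iso B (\<theta> X)) \<and>
     (\<forall>X Y. \<forall>f \<in> Hom A X Y. \<theta> Y \<cdot>\<^bsub>B\<^esub> FA F f = FA G f \<cdot>\<^bsub>B\<^esub> \<theta> X)"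

definition id_fctr :: "('a, 'b, 'a, 'b) fctr" where
  "id_fctr = \<lparr>FO = (\<lambda>X. X), FA = (\<lambda>f. f)\<rparr>"

definition cmp_fctr ::
  "('o, 'm, 'p, 'q, 'w) fctr_scheme \<Rightarrow> ('a, 'b, 'o, 'm, 'x) fctr_scheme \<Rightarrow> ('a, 'b, 'p, 'q) fctr" where
  "cmp_fctr G F = \<lparr>FO = (\<lambda>X. FO G (FO F X)), FA = (\<lambda>f. FA G (FA F f))\<rparr>"

definition equivalence ::
  "('a, 'b, 'y) cat_scheme \<Rightarrow> ('o, 'm, 'z) cat_scheme \<Rightarrow> ('a, 'b, 'o, 'm, 'x) fctr_scheme \<Rightarrow> bool" where
  "equivalence A B F \<longleftrightarrow> is_functor A B F \<and>
     (\<exists>G :: ('o, 'm, 'a, 'b) fctr. is_functor B A G \<and>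
        (\<exists>\<theta>. natural_iso A A (cmp_fctr G F) id_fctr \<theta>) \<and>
        (\<exists>\<theta>. natural_iso B B (cmp_fctr F G) id_fctr \<theta>))"

text \<open>A (strong) tensor functor carries isomorphisms \<open>FMu X Y : F X \<odot> F Y \<rightarrow> F (X \<odot> Y)\<close>
  and \<open>FEps : 1 \<rightarrow> F 1\<close>.\<close>

record ('a, 'b, 'o, 'm) tfctr = "('a, 'b, 'o, 'm) fctr" +
  FMu :: "'a \<Rightarrow> 'a \<Rightarrow> 'm"
  FEps :: "'m"

locale tensor_functor = A: tensor_category A + B: tensor_category B + is_functor A B F
  for A :: "('a, 'b, 'y) tcat_scheme" and B :: "('o, 'm, 'z) tcat_scheme"
    and F :: "('a, 'b, 'o, 'm, 'x) tfctr_scheme" +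
  assumes mu_in: "X \<in> Obj A \<Longrightarrow> Y \<in> Obj A \<Longrightarrow>
       FMu F X Y \<in> Hom B (FO F X \<odot>\<^bsub>B\<^esub> FO F Y) (FO F (X \<odot>\<^bsub>A\<^esub> Y)) \<and> is_iso B (FMu F X Y)"
    and eps_in: "FEps F \<in> Hom B (Unit B) (FO F (Unit A)) \<and> is_iso B (FEps F)"
    and mu_nat: "f \<in> Hom A X X' \<Longrightarrow> g \<in> Hom A Y Y' \<Longrightarrow>
       FMu F X' Y' \<cdot>\<^bsub>B\<^esub> (FA F f \<otimes>\<^bsub>B\<^esub> FA F g) = FA F (f \<otimes>\<^bsub>A\<^esub> g) \<cdot>\<^bsub>B\<^esub> FMu F X Y"
    and mu_asc: "X \<in> Obj A \<Longrightarrow> Y \<in> Obj A \<Longrightarrow> Z \<in> Obj A \<Longrightarrow>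
       FA F (Asc A X Y Z) \<cdot>\<^bsub>B\<^esub> (FMu F (X \<odot>\<^bsub>A\<^esub> Y) Z \<cdot>\<^bsub>B\<^esub> (FMu F X Y \<otimes>\<^bsub>B\<^esub> Ide B (FO F Z))) =
       FMu F X (Y \<odot>\<^bsub>A\<^esub> Z) \<cdot>\<^bsub>B\<^esub>
         ((Ide B (FO F X) \<otimes>\<^bsub>B\<^esub> FMu F Y Z) \<cdot>\<^bsub>B\<^esub> Asc B (FO F X) (FO F Y) (FO F Z))"
    and mu_lun: "X \<in> Obj A \<Longrightarrow>
       FA F (LUn A X) \<cdot>\<^bsub>B\<^esub> (FMu F (Unit A) X \<cdot>\<^bsub>B\<^esub> (FEps F \<otimes>\<^bsub>B\<^esub> Ide B (FO F X))) = LUn B (FO F X)"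
    and mu_run: "X \<in> Obj A \<Longrightarrow>
       FA F (RUn A X) \<cdot>\<^bsub>B\<^esub> (FMu F X (Unit A) \<cdot>\<^bsub>B\<^esub> (Ide B (FO F X) \<otimes>\<^bsub>B\<^esub> FEps F)) = RUn B (FO F X)"
    and mu_brd: "X \<in> Obj A \<Longrightarrow> Y \<in> Obj A \<Longrightarrow>
       FA F (Brd A X Y) \<cdot>\<^bsub>B\<^esub> FMu F X Y = FMu F Y X \<cdot>\<^bsub>B\<^esub> Brd B (FO F X) (FO F Y)"

text \<open>The 1-cells of \<open>Ex\<^sup>\<otimes>\<close>.\<close>

locale exact_tensor_functor =
  A: ex_tensor_category A + B: ex_tensor_category B + tensor_functor A B F
  for A :: "('a, 'b, 'y) lcat_scheme" and B :: "('o, 'm, 'z) lcat_scheme"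
    and F :: "('a, 'b, 'o, 'm, 'x) tfctr_scheme" +
  assumes fa_add: "f \<in> Hom A X Y \<Longrightarrow> g \<in> Hom A X Y \<Longrightarrow> FA F (f \<oplus>\<^bsub>A\<^esub> g) = FA F f \<oplus>\<^bsub>B\<^esub> FA F g"
    and fa_scl: "f \<in> Hom A X Y \<Longrightarrow> FA F (Scl A a f) = Scl B a (FA F f)"
    and fa_kernel: "is_kernel A f k \<Longrightarrow> is_kernel B (FA F f) (FA F k)"
    and fa_cokernel: "is_cokernel A f c \<Longrightarrow> is_cokernel B (FA F f) (FA F c)"

definition cmp_tfctr ::
  "('p, 'q, 'r) cat_scheme \<Rightarrow> ('o, 'm, 'p, 'q) tfctr \<Rightarrow> ('a, 'b, 'o, 'm) tfctr \<Rightarrow> ('a, 'b, 'p, 'q) tfctr" where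
  "cmp_tfctr D G F =
     \<lparr>FO = (\<lambda>X. FO G (FO F X)), FA = (\<lambda>f. FA G (FA F f)),
      FMu = (\<lambda>X Y. FA G (FMu F X Y) \<cdot>\<^bsub>D\<^esub> FMu G (FO F X) (FO F Y)),
      FEps = FA G (FEps F) \<cdot>\<^bsub>D\<^esub> FEps G\<rparr>"

text \<open>Isomorphism of tensor functors, i.e. invertible 2-cells of \<open>Ex\<^sup>\<otimes>\<close>.\<close>

definition tensor_iso ::
  "('a, 'b, 'y) tcat_scheme \<Rightarrow> ('o, 'm, 'z) tcat_scheme \<Rightarrow>
   ('a, 'b, 'o, 'm) tfctr \<Rightarrow> ('a, 'b, 'o, 'm) tfctr \<Rightarrow> bool" where
  "tensor_iso A B F G \<longleftrightarrow> (\<exists>\<theta>. natural_iso A B F G \<theta> \<and>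
     (\<forall>X \<in> Obj A. \<forall>Y \<in> Obj A.
        \<theta> (X \<odot>\<^bsub>A\<^esub> Y) \<cdot>\<^bsub>B\<^esub> FMu F X Y = FMu G X Y \<cdot>\<^bsub>B\<^esub> (\<theta> X \<otimes>\<^bsub>B\<^esub> \<theta> Y)) \<and>
     \<theta> (Unit A) \<cdot>\<^bsub>B\<^esub> FEps F = FEps G)"


section \<open>Kernels and Serre quotients\<close>

definition Ker :: "('a, 'b, 'y) cat_scheme \<Rightarrow> ('o, 'm, 'z) cat_scheme \<Rightarrow>
    ('a, 'b, 'o, 'm, 'x) fctr_scheme \<Rightarrow> 'a set" where
  "Ker A B F = {X \<in> Obj A. is_zero B (FO F X)}"

text \<open>The intersection of the \<open>Ker F\<^sub>H\<close>, for \<open>H\<close> in a class \<open>S\<close> of cohomologies, each given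
  together with its category of values.\<close>

definition joint_Ker :: "('o, 'm) lcat \<Rightarrow> (('p, 'q) lcat \<times> 'h) set \<Rightarrow>
    (('p, 'q) lcat \<times> 'h \<Rightarrow> ('o, 'm, 'p, 'q) tfctr) \<Rightarrow> 'o set" where
  "joint_Ker A S F = {X \<in> Obj A. \<forall>h \<in> S. X \<in> Ker A (fst h) (F h)}"

definition serre_tensor_ideal :: "('o, 'm, 'z) lcat_scheme \<Rightarrow> 'o set \<Rightarrow> bool" where
  "serre_tensor_ideal A K \<longleftrightarrow> K \<subseteq> Obj A \<and> (\<forall>Z. is_zero A Z \<longrightarrow> Z \<in> K) \<and>
     (\<forall>f g. short_exact A f g \<longrightarrow> (Cod A f \<in> K \<longleftrightarrow> Dom A f \<in> K \<and> Cod A g \<in> K)) \<and>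
     (\<forall>X \<in> K. \<forall>Y \<in> Obj A. X \<odot>\<^bsub>A\<^esub> Y \<in> K \<and> Y \<odot>\<^bsub>A\<^esub> X \<in> K)"

text \<open>Gabriel's description of the Serre quotient \<open>A/K\<close>.  It has the objects of \<open>A\<close>, and
  \<open>Hom X Y\<close> in \<open>A/K\<close> is the filtered colimit of \<open>Hom X' (Y/Y')\<close> in \<open>A\<close> over the subobjects
  \<open>s : X' \<rightarrow> X\<close> with \<open>X/X'\<close> in \<open>K\<close> and the quotients \<open>t : Y \<rightarrow> Y/Y'\<close> with \<open>Y'\<close> in \<open>K\<close>, the
  class of \<open>(s, f, t)\<close> being the composite \<open>(Q t)\<inverse> \<cdot> Q f \<cdot> (Q s)\<inverse>\<close>.  This determines the category
  \<open>A/K\<close> and \<open>Q\<close> up to unique isomorphism; the tensor structure on \<open>A/K\<close> is the one for which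
  \<open>Q\<close> is a tensor functor.\<close>

definition co_K_sub :: "('o, 'm, 'z) lcat_scheme \<Rightarrow> 'o set \<Rightarrow> 'm \<Rightarrow> bool" where
  "co_K_sub A K s \<longleftrightarrow> monic A s \<and> (\<exists>c. is_cokernel A s c \<and> Cod A c \<in> K)"

definition K_quot :: "('o, 'm, 'z) lcat_scheme \<Rightarrow> 'o set \<Rightarrow> 'm \<Rightarrow> bool" where
  "K_quot A K t \<longleftrightarrow> epic A t \<and> (\<exists>k. is_kernel A t k \<and> Dom A k \<in> K)"

definition roof ::
  "('o, 'm, 'z) lcat_scheme \<Rightarrow> 'o set \<Rightarrow> 'o \<Rightarrow> 'o \<Rightarrow> 'm \<Rightarrow> 'm \<Rightarrow> 'm \<Rightarrow> bool" where
  "roof A K X Y s f t \<longleftrightarrow> co_K_sub A K s \<and> Cod A s = X \<and> K_quot A K t \<and> Dom A t = Y \<and>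
     f \<in> Hom A (Dom A s) (Cod A t)"

definition roof_eq :: "('o, 'm, 'z) lcat_scheme \<Rightarrow> 'o set \<Rightarrow> 'o \<Rightarrow> 'o \<Rightarrow>
    'm \<Rightarrow> 'm \<Rightarrow> 'm \<Rightarrow> 'm \<Rightarrow> 'm \<Rightarrow> 'm \<Rightarrow> bool" where
  "roof_eq A K X Y s f t s' f' t' \<longleftrightarrow>
     (\<exists>s'' f'' t''. \<exists>a \<in> Hom A (Dom A s'') (Dom A s). \<exists>b \<in> Hom A (Cod A t) (Cod A t'').
        \<exists>a' \<in> Hom A (Dom A s'') (Dom A s'). \<exists>b' \<in> Hom A (Cod A t') (Cod A t'').
        roof A K X Y s'' f'' t'' \<and>
        s \<cdot>\<^bsub>A\<^esub> a = s'' \<and> s' \<cdot>\<^bsub>A\<^esub> a' = s'' \<and> b \<cdot>\<^bsub>A\<^esub> t = t'' \<and> b' \<cdot>\<^bsub>A\<^esub> t' = t'' \<and>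
        b \<cdot>\<^bsub>A\<^esub> (f \<cdot>\<^bsub>A\<^esub> a) = f'' \<and> b' \<cdot>\<^bsub>A\<^esub> (f' \<cdot>\<^bsub>A\<^esub> a') = f'')"

definition roof_arr ::
  "('o, 'm, 'z) cat_scheme \<Rightarrow> ('a, 'b, 'o, 'm, 'x) fctr_scheme \<Rightarrow> 'b \<Rightarrow> 'b \<Rightarrow> 'b \<Rightarrow> 'm" where
  "roof_arr B Q s f t = inv_arr B (FA Q t) \<cdot>\<^bsub>B\<^esub> (FA Q f \<cdot>\<^bsub>B\<^esub> inv_arr B (FA Q s))"

definition is_serre_quotient ::
  "('o, 'm) lcat \<Rightarrow> 'o set \<Rightarrow> ('o, 'q) lcat \<Rightarrow> ('o, 'm, 'o, 'q) tfctr \<Rightarrow> bool" where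
  "is_serre_quotient A K B Q \<longleftrightarrow>
     serre_tensor_ideal A K \<and> exact_tensor_functor A B Q \<and>
     Obj B = Obj A \<and> (\<forall>X \<in> Obj A. FO Q X = X) \<and>
     (\<forall>s. co_K_sub A K s \<longrightarrow> is_iso B (FA Q s)) \<and>
     (\<forall>t. K_quot A K t \<longrightarrow> is_iso B (FA Q t)) \<and>
     (\<forall>X \<in> Obj A. \<forall>Y \<in> Obj A. \<forall>g \<in> Hom B X Y. \<exists>s f t. roof A K X Y s f t \<and> g = roof_arr B Q s f t) \<and>
     (\<forall>X Y s f t s' f' t'. roof A K X Y s f t \<and> roof A K X Y s' f' t' \<longrightarrow>
        (roof_arr B Q s f t = roof_arr B Q s' f' t' \<longleftrightarrow> roof_eq A K X Y s f t s' f' t'))"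

definition equivalent_under ::
  "('a, 'b) lcat \<Rightarrow> ('o, 'm) lcat \<Rightarrow> ('a, 'b, 'o, 'm) tfctr \<Rightarrow> ('p, 'q) lcat \<Rightarrow> ('a, 'b, 'p, 'q) tfctr \<Rightarrow> bool" where
  "equivalent_under A B P B' P' \<longleftrightarrow>
     (\<exists>E. exact_tensor_functor B B' E \<and> equivalence B B' E \<and> tensor_iso A B' (cmp_tfctr B' E P) P')"

text \<open>\<open>G : B \<rightarrow> D\<close> is induced by \<open>F : A \<rightarrow> D\<close> along \<open>P : A \<rightarrow> B\<close>.\<close>

definition induced_by :: "('a, 'b) lcat \<Rightarrow> ('o, 'm) lcat \<Rightarrow> ('p, 'q) lcat \<Rightarrow>
    ('a, 'b, 'o, 'm) tfctr \<Rightarrow> ('a, 'b, 'p, 'q) tfctr \<Rightarrow> ('o, 'm, 'p, 'q) tfctr \<Rightarrow> bool" where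
  "induced_by A B D P F G \<longleftrightarrow> exact_tensor_functor B D G \<and> tensor_iso A D (cmp_tfctr D G P) F"


section \<open>Kuenneth cohomologies\<close>

text \<open>\<open>HO i X\<close> is \<open>H\<^sup>i(X)\<close>, \<open>HA i\<close> the contravariant action on arrows, \<open>Kap i j X Y\<close> the
  external product and \<open>Ups\<close> the isomorphism \<open>H\<^sup>0(1) \<cong> 1\<close>.\<close>

record ('c, 'd, 'o, 'm) coh =
  HO :: "nat \<Rightarrow> 'c \<Rightarrow> 'o"
  HA :: "nat \<Rightarrow> 'd \<Rightarrow> 'm"
  Kap :: "nat \<Rightarrow> nat \<Rightarrow> 'c \<Rightarrow> 'c \<Rightarrow> 'm"
  Ups :: "'m"

text \<open>The base is an arbitrary tensor category \<open>T\<close>, so that the definition applies both to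
  \<open>(C, \<times>, 1)\<close> and to the category of pairs.\<close>

locale kunneth_cohomology = T: tensor_category T + A: ex_tensor_category A
  for T :: "('c, 'd, 'y) tcat_scheme" and A :: "('o, 'm, 'z) lcat_scheme" +
  fixes H :: "('c, 'd, 'o, 'm, 'x) coh_scheme"
  assumes ho_in: "X \<in> Obj T \<Longrightarrow> HO H i X \<in> Obj A"
    and ha_in: "f \<in> Hom T X Y \<Longrightarrow> HA H i f \<in> Hom A (HO H i Y) (HO H i X)"
    and ha_ide: "X \<in> Obj T \<Longrightarrow> HA H i (Ide T X) = Ide A (HO H i X)"
    and ha_cmp: "f \<in> Hom T X Y \<Longrightarrow> g \<in> Hom T Y Z \<Longrightarrow> HA H i (g \<cdot>\<^bsub>T\<^esub> f) = HA H i f \<cdot>\<^bsub>A\<^esub> HA H i g"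
    and kap_in: "X \<in> Obj T \<Longrightarrow> Y \<in> Obj T \<Longrightarrow>
       Kap H i j X Y \<in> Hom A (HO H i X \<odot>\<^bsub>A\<^esub> HO H j Y) (HO H (i + j) (X \<odot>\<^bsub>T\<^esub> Y))"
    and kap_nat: "f \<in> Hom T X X' \<Longrightarrow> g \<in> Hom T Y Y' \<Longrightarrow>
       Kap H i j X Y \<cdot>\<^bsub>A\<^esub> (HA H i f \<otimes>\<^bsub>A\<^esub> HA H j g) =
       HA H (i + j) (f \<otimes>\<^bsub>T\<^esub> g) \<cdot>\<^bsub>A\<^esub> Kap H i j X' Y'"
    and kap_asc: "X \<in> Obj T \<Longrightarrow> Y \<in> Obj T \<Longrightarrow> Z \<in> Obj T \<Longrightarrow>
       Kap H (i + j) k (X \<odot>\<^bsub>T\<^esub> Y) Z \<cdot>\<^bsub>A\<^esub> (Kap H i j X Y \<otimes>\<^bsub>A\<^esub> Ide A (HO H k Z)) =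
       HA H (i + j + k) (Asc T X Y Z) \<cdot>\<^bsub>A\<^esub>
         (Kap H i (j + k) X (Y \<odot>\<^bsub>T\<^esub> Z) \<cdot>\<^bsub>A\<^esub>
           ((Ide A (HO H i X) \<otimes>\<^bsub>A\<^esub> Kap H j k Y Z) \<cdot>\<^bsub>A\<^esub> Asc A (HO H i X) (HO H j Y) (HO H k Z)))"
    and ups_iso: "Ups H \<in> Hom A (HO H 0 (Unit T)) (Unit A) \<and> is_iso A (Ups H)"
    and ho_unit: "i \<noteq> 0 \<Longrightarrow> is_zero A (HO H i (Unit T))"
    and kap_lun: "X \<in> Obj T \<Longrightarrow>
       Kap H 0 i (Unit T) X =
       HA H i (LUn T X) \<cdot>\<^bsub>A\<^esub> (LUn A (HO H i X) \<cdot>\<^bsub>A\<^esub> (Ups H \<otimes>\<^bsub>A\<^esub> Ide A (HO H i X)))"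
    and kap_run: "X \<in> Obj T \<Longrightarrow>
       Kap H i 0 X (Unit T) =
       HA H i (RUn T X) \<cdot>\<^bsub>A\<^esub> (RUn A (HO H i X) \<cdot>\<^bsub>A\<^esub> (Ide A (HO H i X) \<otimes>\<^bsub>A\<^esub> Ups H))"
    and kap_brd: "X \<in> Obj T \<Longrightarrow> Y \<in> Obj T \<Longrightarrow>
       Kap H i j X Y =
       Scl A ((-1) ^ (i * j))
         (HA H (i + j) (Brd T X Y) \<cdot>\<^bsub>A\<^esub> (Kap H j i Y X \<cdot>\<^bsub>A\<^esub> Brd A (HO H i X) (HO H j Y)))"
    and kap_sum_iso: "X \<in> Obj T \<Longrightarrow> Y \<in> Obj T \<Longrightarrow>
       \<exists>S \<iota> \<sigma>. is_coproduct A {(i, j). i + j = k} (\<lambda>(i, j). HO H i X \<odot>\<^bsub>A\<^esub> HO H j Y) S \<iota> \<and>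
         \<sigma> \<in> Hom A S (HO H k (X \<odot>\<^bsub>T\<^esub> Y)) \<and>
         (\<forall>i j. i + j = k \<longrightarrow> \<sigma> \<cdot>\<^bsub>A\<^esub> \<iota> (i, j) = Kap H i j X Y) \<and> is_iso A \<sigma>"

definition push ::
  "('a, 'b) lcat \<Rightarrow> ('o, 'm) lcat \<Rightarrow> ('a, 'b, 'o, 'm) tfctr \<Rightarrow>
   ('c, 'd, 'a, 'b, 'x) coh_scheme \<Rightarrow> ('c, 'd, 'o, 'm) coh" where
  "push A B F H =
     \<lparr>HO = (\<lambda>i X. FO F (HO H i X)), HA = (\<lambda>i f. FA F (HA H i f)),
      Kap = (\<lambda>i j X Y. FA F (Kap H i j X Y) \<cdot>\<^bsub>B\<^esub> FMu F (HO H i X) (HO H j Y)),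
      Ups = inv_arr B (FEps F) \<cdot>\<^bsub>B\<^esub> FA F (Ups H)\<rparr>"

definition coh_iso_via ::
  "('c, 'd, 'y) tcat_scheme \<Rightarrow> ('o, 'm) lcat \<Rightarrow> ('c, 'd, 'o, 'm, 'w) coh_scheme \<Rightarrow>
   ('c, 'd, 'o, 'm, 'x) coh_scheme \<Rightarrow> (nat \<Rightarrow> 'c \<Rightarrow> 'm) \<Rightarrow> bool" where
  "coh_iso_via T A H H' \<phi> \<longleftrightarrow>
     (\<forall>i. \<forall>X \<in> Obj T. \<phi> i X \<in> Hom A (HO H i X) (HO H' i X) \<and> is_iso A (\<phi> i X)) \<and>
     (\<forall>i X Y. \<forall>f \<in> Hom T X Y. \<phi> i X \<cdot>\<^bsub>A\<^esub> HA H i f = HA H' i f \<cdot>\<^bsub>A\<^esub> \<phi> i Y) \<and>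
     (\<forall>i j. \<forall>X \<in> Obj T. \<forall>Y \<in> Obj T.
        \<phi> (i + j) (X \<odot>\<^bsub>T\<^esub> Y) \<cdot>\<^bsub>A\<^esub> Kap H i j X Y = Kap H' i j X Y \<cdot>\<^bsub>A\<^esub> (\<phi> i X \<otimes>\<^bsub>A\<^esub> \<phi> j Y)) \<and>
     Ups H' \<cdot>\<^bsub>A\<^esub> \<phi> 0 (Unit T) = Ups H"

definition coh_iso ::
  "('c, 'd) tcat \<Rightarrow> ('o, 'm) lcat \<Rightarrow> ('c, 'd, 'o, 'm) coh \<Rightarrow> ('c, 'd, 'o, 'm) coh \<Rightarrow> bool" where
  "coh_iso T A H H' \<longleftrightarrow> (\<exists>\<phi>. coh_iso_via T A H H' \<phi>)"

text \<open>\<open>H\<close>, with values in \<open>B\<close>, is the push-forward of \<open>U\<close> along the exact tensor functor \<open>F : A \<rightarrow> B\<close>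
  (a functor \<open>F\<^sub>H\<close> when \<open>U\<close> is universal).  Equality of cohomologies is up to isomorphism.\<close>

definition classifies :: "('c, 'd) tcat \<Rightarrow> ('a, 'b) lcat \<Rightarrow> ('c, 'd, 'a, 'b) coh \<Rightarrow>
    ('o, 'm) lcat \<Rightarrow> ('c, 'd, 'o, 'm) coh \<Rightarrow> ('a, 'b, 'o, 'm) tfctr \<Rightarrow> bool" where
  "classifies T A U B H F \<longleftrightarrow> exact_tensor_functor A B F \<and> coh_iso T B (push A B F U) H"

text \<open>The types \<open>'o\<close> of objects and \<open>'m\<close> of arrows play the role of the universe over which
  the objects of \<open>Ex\<^sup>\<otimes>\<close> range.\<close>

definition universal_kunneth ::
  "('c, 'd) tcat \<Rightarrow> ('o, 'm) lcat \<Rightarrow> ('c, 'd, 'o, 'm) coh \<Rightarrow> bool" where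
  "universal_kunneth T A U \<longleftrightarrow> kunneth_cohomology T A U \<and>
     (\<forall>(B :: ('o, 'm) lcat) H. kunneth_cohomology T B H \<longrightarrow>
        (\<exists>F. classifies T A U B H F) \<and>
        (\<forall>F F'. classifies T A U B H F \<and> classifies T A U B H F' \<longrightarrow> tensor_iso A B F F'))"

definition realisation :: "('c, 'd) tcat \<Rightarrow> ('a, 'b) lcat \<Rightarrow> ('c, 'd, 'a, 'b) coh \<Rightarrow>
    ('o, 'm) lcat \<Rightarrow> ('c, 'd, 'o, 'm) coh \<Rightarrow> ('a, 'b, 'o, 'm) tfctr \<Rightarrow> bool" where
  "realisation T A U B H r \<longleftrightarrow> classifies T A U B H r \<and> faithful A r"


section \<open>Pairs and relative Kuenneth cohomologies\<close>

text \<open>Subobjects are represented by monomorphisms: the pair \<open>(X, Y)\<close> is a distinguished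
  monomorphism \<open>i : Y \<rightarrow> X\<close>, and \<open>M\<close> is the class of these.  A morphism of pairs \<open>i \<rightarrow> j\<close> is an arrow
  \<open>f : Cod i \<rightarrow> Cod j\<close> mapping the subobject \<open>i\<close> into the subobject \<open>j\<close>, recorded as \<open>(i, f, j)\<close>.\<close>

definition sub_le :: "('o, 'm, 'z) cat_scheme \<Rightarrow> 'm \<Rightarrow> 'm \<Rightarrow> bool" where
  "sub_le C i j \<longleftrightarrow> (\<exists>g \<in> Hom C (Dom C i) (Dom C j). j \<cdot>\<^bsub>C\<^esub> g = i)"

definition is_union :: "('o, 'm, 'z) cat_scheme \<Rightarrow> 'm set \<Rightarrow> 'm \<Rightarrow> 'm \<Rightarrow> 'm \<Rightarrow> bool" where
  "is_union C M i j u \<longleftrightarrow> u \<in> M \<and> Cod C u = Cod C i \<and> sub_le C i u \<and> sub_le C j u \<and>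
     (\<forall>v \<in> M. Cod C v = Cod C i \<and> sub_le C i v \<and> sub_le C j v \<longrightarrow> sub_le C u v)"

definition from_empty :: "('o, 'm, 'z) cat_scheme \<Rightarrow> 'o \<Rightarrow> 'o \<Rightarrow> 'm" where
  "from_empty C emp X = (THE f. f \<in> Hom C emp X)"

text \<open>\<open>(X, Y) \<times> (X', Y') = (X \<times> X', X \<times> Y' \<union> Y \<times> X')\<close>\<close>

definition pair_ten :: "('o, 'm, 'z) tcat_scheme \<Rightarrow> ('m \<Rightarrow> 'm \<Rightarrow> 'm) \<Rightarrow> 'm \<Rightarrow> 'm \<Rightarrow> 'm" where
  "pair_ten C un i i' = un (Ide C (Cod C i) \<otimes>\<^bsub>C\<^esub> i') (i \<otimes>\<^bsub>C\<^esub> Ide C (Cod C i'))"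

definition pair_cat :: "('o, 'm) tcat \<Rightarrow> 'm set \<Rightarrow> ('m \<Rightarrow> 'm \<Rightarrow> 'm) \<Rightarrow> 'o \<Rightarrow>
    ('m, 'm \<times> 'm \<times> 'm) tcat" where
  "pair_cat C M un emp =
     (let c = Cod C; t = pair_ten C un; e = from_empty C emp (Unit C) in
     \<lparr>Obj = M,
      Arr = {(i, f, j). i \<in> M \<and> j \<in> M \<and> f \<in> Hom C (c i) (c j) \<and> (\<exists>g \<in> Hom C (Dom C i) (Dom C j). j \<cdot>\<^bsub>C\<^esub> g = f \<cdot>\<^bsub>C\<^esub> i)},
      Dom = (\<lambda>(i, f, j). i),
      Cod = (\<lambda>(i, f, j). j),
      Ide = (\<lambda>i. (i, Ide C (c i), i)),
      Cmp = (\<lambda>(_, g, k) (i, f, _). (i, g \<cdot>\<^bsub>C\<^esub> f, k)),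
      TenO = t,
      TenA = (\<lambda>(i, f, j) (i', f', j'). (t i i', f \<otimes>\<^bsub>C\<^esub> f', t j j')),
      Unit = e,
      Asc = (\<lambda>i j k. (t (t i j) k, Asc C (c i) (c j) (c k), t i (t j k))),
      LUn = (\<lambda>i. (t e i, LUn C (c i), i)),
      RUn = (\<lambda>i. (t i e, RUn C (c i), i)),
      Brd = (\<lambda>i j. (t i j, Brd C (c i) (c j), t j i))\<rparr>)"

text \<open>\<open>un\<close> chooses unions and \<open>emp\<close> is the empty (initial) object.  Intersections are pullbacks.
  That \<open>(X, Y) \<times> (X', Y')\<close> is a tensor structure on pairs is part of the hypotheses; it contains the
  distributivity of \<open>\<times>\<close> over unions and \<open>\<emptyset> \<times> X = \<emptyset>\<close>.\<close>

locale pair_category = cartesian_category C for C :: "('o, 'm) tcat" (structure) +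
  fixes M :: "'m set" and un :: "'m \<Rightarrow> 'm \<Rightarrow> 'm" and emp :: "'o"
  assumes dist_monic: "i \<in> M \<Longrightarrow> monic C i"
    and dist_iso: "is_iso C i \<Longrightarrow> i \<in> M"
    and dist_cmp: "i \<in> M \<Longrightarrow> j \<in> M \<Longrightarrow> Cod C j = Dom C i \<Longrightarrow> i \<cdot> j \<in> M"
    and dist_cancel: "i \<in> M \<Longrightarrow> j \<in> Arr C \<Longrightarrow> Cod C j = Dom C i \<Longrightarrow> i \<cdot> j \<in> M \<Longrightarrow> j \<in> M"
    and dist_inter: "i \<in> M \<Longrightarrow> j \<in> M \<Longrightarrow> Cod C i = Cod C j \<Longrightarrow>
                     \<exists>p \<in> M. \<exists>q \<in> M. is_pullback C i j p q"
    and dist_union: "i \<in> M \<Longrightarrow> j \<in> M \<Longrightarrow> Cod C i = Cod C j \<Longrightarrow> is_union C M i j (un i j)"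
    and dist_ten: "i \<in> M \<Longrightarrow> X \<in> Obj C \<Longrightarrow> Ide C X \<otimes> i \<in> M \<and> i \<otimes> Ide C X \<in> M"
    and emp_initial: "is_initial C emp"
    and emp_dist: "X \<in> Obj C \<Longrightarrow> from_empty C emp X \<in> M"
    and pair_tensor: "tensor_category (pair_cat C M un emp)"

text \<open>\<open>Bd n i j\<close>, for \<open>j : Z \<rightarrow> Y\<close> and \<open>i : Y \<rightarrow> X\<close>, is the boundary
  \<open>H\<^sup>n(Y, Z) \<rightarrow> H\<^sup>n\<^sup>+\<^sup>1(X, Y)\<close>.\<close>

record ('c, 'd, 'o, 'm) rel_coh = "('c, 'd, 'o, 'm) coh" +
  Bd :: "nat \<Rightarrow> 'c \<Rightarrow> 'c \<Rightarrow> 'm"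

locale relative_kunneth_cohomology =
  P: pair_category C M un emp + kunneth_cohomology "pair_cat C M un emp" A H
  for C :: "('c, 'd) tcat" and M :: "'d set" and un :: "'d \<Rightarrow> 'd \<Rightarrow> 'd" and emp :: "'c"
    and A :: "('o, 'm) lcat" and H :: "('d, 'd \<times> 'd \<times> 'd, 'o, 'm) rel_coh" +
  assumes bd_in: "i \<in> M \<Longrightarrow> j \<in> M \<Longrightarrow> Cod C j = Dom C i \<Longrightarrow>
       Bd H n i j \<in> Hom A (HO H n j) (HO H (n + 1) i)"
    and bd_nat: "i \<in> M \<Longrightarrow> j \<in> M \<Longrightarrow> Cod C j = Dom C i \<Longrightarrow>
       i' \<in> M \<Longrightarrow> j' \<in> M \<Longrightarrow> Cod C j' = Dom C i' \<Longrightarrow>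
       f \<in> Hom C (Cod C i) (Cod C i') \<Longrightarrow> g \<in> Hom C (Dom C i) (Dom C i') \<Longrightarrow>
       h \<in> Hom C (Dom C j) (Dom C j') \<Longrightarrow>
       i' \<cdot>\<^bsub>C\<^esub> g = f \<cdot>\<^bsub>C\<^esub> i \<Longrightarrow> j' \<cdot>\<^bsub>C\<^esub> h = g \<cdot>\<^bsub>C\<^esub> j \<Longrightarrow>
       HA H (n + 1) (i, f, i') \<cdot>\<^bsub>A\<^esub> Bd H n i' j' = Bd H n i j \<cdot>\<^bsub>A\<^esub> HA H n (j, g, j')"
    \<comment> \<open>\<open>0 \<rightarrow> H\<^sup>0(X, Y) \<rightarrow> H\<^sup>0(X, Z) \<rightarrow> H\<^sup>0(Y, Z) \<rightarrow> H\<^sup>1(X, Y) \<rightarrow> \<dots>\<close> for \<open>j : Z \<rightarrow> Y\<close>, \<open>i : Y \<rightarrow> X\<close>\<close>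
    and les_start: "i \<in> M \<Longrightarrow> j \<in> M \<Longrightarrow> Cod C j = Dom C i \<Longrightarrow>
       monic A (HA H 0 (i \<cdot>\<^bsub>C\<^esub> j, Ide C (Cod C i), i))"
    and les_XZ: "i \<in> M \<Longrightarrow> j \<in> M \<Longrightarrow> Cod C j = Dom C i \<Longrightarrow>
       exact_at A (HA H n (i \<cdot>\<^bsub>C\<^esub> j, Ide C (Cod C i), i)) (HA H n (j, i, i \<cdot>\<^bsub>C\<^esub> j))"
    and les_YZ: "i \<in> M \<Longrightarrow> j \<in> M \<Longrightarrow> Cod C j = Dom C i \<Longrightarrow>
       exact_at A (HA H n (j, i, i \<cdot>\<^bsub>C\<^esub> j)) (Bd H n i j)"
    and les_XY: "i \<in> M \<Longrightarrow> j \<in> M \<Longrightarrow> Cod C j = Dom C i \<Longrightarrow>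
       exact_at A (Bd H n i j) (HA H (n + 1) (i \<cdot>\<^bsub>C\<^esub> j, Ide C (Cod C i), i))"
    \<comment> \<open>\<open>i : Y \<rightarrow> X\<close>, \<open>j : Z \<rightarrow> X\<close>, \<open>X = Y \<union> Z\<close> and \<open>p : Y \<inter> Z \<rightarrow> Y\<close>\<close>
    and excision: "i \<in> M \<Longrightarrow> j \<in> M \<Longrightarrow> Cod C i = Cod C j \<Longrightarrow> is_union C M i j (Ide C (Cod C i)) \<Longrightarrow>
       p \<in> M \<Longrightarrow> q \<in> M \<Longrightarrow> is_pullback C i j p q \<Longrightarrow> is_iso A (HA H n (p, i, j))"
    \<comment> \<open>\<open>i : Y \<rightarrow> X\<close>, \<open>i' : Y' \<rightarrow> X'\<close>, \<open>w : W = X \<times> Y' \<union> Y \<times> X' \<rightarrow> X \<times> X'\<close>, and \<open>a : Y \<times> X' \<rightarrow> W\<close>,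
       \<open>b : X \<times> Y' \<rightarrow> W\<close> are the inclusions.  The factor at \<open>Ide C (Dom C i \<odot> Cod C i')\<close> is the
       identification of \<open>(Y, \<emptyset>) \<times> (X', Y')\<close> with \<open>(Y \<times> X', Y \<times> Y')\<close>.\<close>
    and kap_bd: "i \<in> M \<Longrightarrow> i' \<in> M \<Longrightarrow> e = from_empty C emp (Dom C i) \<Longrightarrow> w = pair_ten C un i i' \<Longrightarrow>
       y = Ide C (Dom C i) \<otimes>\<^bsub>C\<^esub> i' \<Longrightarrow>
       a \<in> Hom C (Dom C i \<odot>\<^bsub>C\<^esub> Cod C i') (Dom C w) \<Longrightarrow> w \<cdot>\<^bsub>C\<^esub> a = i \<otimes>\<^bsub>C\<^esub> Ide C (Cod C i') \<Longrightarrow>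
       b \<in> Hom C (Cod C i \<odot>\<^bsub>C\<^esub> Dom C i') (Dom C w) \<Longrightarrow> w \<cdot>\<^bsub>C\<^esub> b = Ide C (Cod C i) \<otimes>\<^bsub>C\<^esub> i' \<Longrightarrow>
       Kap H (n + 1) m i i' \<cdot>\<^bsub>A\<^esub> (Bd H n i e \<otimes>\<^bsub>A\<^esub> Ide A (HO H m i')) =
       Bd H (n + m) w b \<cdot>\<^bsub>A\<^esub>
         (inv_arr A (HA H (n + m) (y, a, b)) \<cdot>\<^bsub>A\<^esub>
           (HA H (n + m) (y, Ide C (Dom C i \<odot>\<^bsub>C\<^esub> Cod C i'), pair_ten C un e i') \<cdot>\<^bsub>A\<^esub>
             Kap H n m e i'))"

definition rel_push :: "('a, 'b) lcat \<Rightarrow> ('o, 'm) lcat \<Rightarrow> ('a, 'b, 'o, 'm) tfctr \<Rightarrow>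
    ('c, 'd, 'a, 'b) rel_coh \<Rightarrow> ('c, 'd, 'o, 'm) rel_coh" where
  "rel_push A B F H =
     coh.extend (push A B F H) (rel_coh.fields (\<lambda>n i j. FA F (Bd H n i j)))"

definition rel_coh_iso :: "('c, 'd) tcat \<Rightarrow> 'd set \<Rightarrow> ('d \<Rightarrow> 'd \<Rightarrow> 'd) \<Rightarrow> 'c \<Rightarrow> ('o, 'm) lcat \<Rightarrow>
    ('d, 'd \<times> 'd \<times> 'd, 'o, 'm) rel_coh \<Rightarrow> ('d, 'd \<times> 'd \<times> 'd, 'o, 'm) rel_coh \<Rightarrow> bool" where
  "rel_coh_iso C M un emp A H H' \<longleftrightarrow>
     (\<exists>\<phi>. coh_iso_via (pair_cat C M un emp) A H H' \<phi> \<and>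
        (\<forall>n. \<forall>i \<in> M. \<forall>j \<in> M. Cod C j = Dom C i \<longrightarrow>
           \<phi> (n + 1) i \<cdot>\<^bsub>A\<^esub> Bd H n i j = Bd H' n i j \<cdot>\<^bsub>A\<^esub> \<phi> n j))"

definition rel_classifies :: "('c, 'd) tcat \<Rightarrow> 'd set \<Rightarrow> ('d \<Rightarrow> 'd \<Rightarrow> 'd) \<Rightarrow> 'c \<Rightarrow>
    ('a, 'b) lcat \<Rightarrow> ('d, 'd \<times> 'd \<times> 'd, 'a, 'b) rel_coh \<Rightarrow>
    ('o, 'm) lcat \<Rightarrow> ('d, 'd \<times> 'd \<times> 'd, 'o, 'm) rel_coh \<Rightarrow> ('a, 'b, 'o, 'm) tfctr \<Rightarrow> bool" where
  "rel_classifies C M un emp A U B H F \<longleftrightarrow>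
     exact_tensor_functor A B F \<and> rel_coh_iso C M un emp B (rel_push A B F U) H"

definition universal_relative_kunneth ::
  "('c, 'd) tcat \<Rightarrow> 'd set \<Rightarrow> ('d \<Rightarrow> 'd \<Rightarrow> 'd) \<Rightarrow> 'c \<Rightarrow>
   ('o, 'm) lcat \<Rightarrow> ('d, 'd \<times> 'd \<times> 'd, 'o, 'm) rel_coh \<Rightarrow> bool" where
  "universal_relative_kunneth C M un emp A U \<longleftrightarrow> relative_kunneth_cohomology C M un emp A U \<and>
     (\<forall>(B :: ('o, 'm) lcat) H. relative_kunneth_cohomology C M un emp B H \<longrightarrow>
        (\<exists>F. rel_classifies C M un emp A U B H F) \<and>
        (\<forall>F F'. rel_classifies C M un emp A U B H F \<and> rel_classifies C M un emp A U B H F' \<longrightarrow>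
           tensor_iso A B F F'))"

definition rel_realisation :: "('c, 'd) tcat \<Rightarrow> 'd set \<Rightarrow> ('d \<Rightarrow> 'd \<Rightarrow> 'd) \<Rightarrow> 'c \<Rightarrow>
    ('a, 'b) lcat \<Rightarrow> ('d, 'd \<times> 'd \<times> 'd, 'a, 'b) rel_coh \<Rightarrow>
    ('o, 'm) lcat \<Rightarrow> ('d, 'd \<times> 'd \<times> 'd, 'o, 'm) rel_coh \<Rightarrow> ('a, 'b, 'o, 'm) tfctr \<Rightarrow> bool" where
  "rel_realisation C M un emp A U B H r \<longleftrightarrow> rel_classifies C M un emp A U B H r \<and> faithful A r"

end

theory Submission
  imports Defs
begin

text \<open>An exact functor between abelian categories is faithful iff it kills only zero objects, and the
  projection to a Serre quotient \<open>A/K\<close> has kernel exactly \<open>K\<close>.  So a functor induced on \<open>A/K\<close> by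
  \<open>F : A \<rightarrow> D\<close> is faithful iff \<open>Ker F = K\<close>.  Applied to \<open>F\<^sub>H\<close>, to the projections and to the
  comparison functors (equivalences are faithful), this turns each of the three conditions into:
  \<open>Ker F\<^sub>H\<close> is the joint kernel for all \<open>H\<close> in \<open>S\<close>.  That \<open>H\<close> is the push-forward along \<open>r\<^sub>H\<close> is
  automatic, because \<open>r\<^sub>H\<close> composed with the projection is isomorphic to \<open>F\<^sub>H\<close>.\<close>

section \<open>Zero objects, kernels and cokernels\<close>

text \<open>The functors \<open>F h\<close>, \<open>r h\<close> and \<open>can h\<close> are fixed
  only up to isomorphism. Kernels do not see this, which is why the argument is routed through them.
  Two points are not formal. That a projection kills nothing outside \<open>K\<close> rests on the
  criterion for equality of roofs, applied to the identity and the zero endomorphism of an object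
  that becomes zero. And a faithful functor need not be an equivalence, so (3) asks for more than a
  comparison of kernels: once the kernels agree, source and target of \<open>can h\<close> are the
  same category, and it remains to see that an endofunctor of a quotient which fixes the projection
  up to isomorphism is isomorphic to the identity. For empty \<open>S\<close> the joint kernel is
  all of \<open>Obj A\<close> and the conditions are vacuous; ideals are therefore intersected over
  non-empty families.\<close>

lemma in_HomD:
  assumes "f \<in> Hom C X Y"
  shows "f \<in> Arr C" "Dom C f = X" "Cod C f = Y"
  using assms by (auto simp: Hom_def)

section \<open>Inverses of arrows\<close>

context category
begin

lemma Hom_objD:
  assumes "f \<in> Hom C X Y"
  shows "X \<in> Obj C" "Y \<in> Obj C"
  using assms dom_in cod_in by (auto simp: Hom_def)

lemma is_inverse_iff:
  assumes "f \<in> Hom C X Y"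
  shows "is_inverse C f g \<longleftrightarrow> g \<in> Hom C Y X \<and> g \<cdot> f = Ide C X \<and> f \<cdot> g = Ide C Y"
  using assms by (auto simp: is_inverse_def Hom_def)

text \<open>\<open>inv_arr\<close> is a definite description, so it is computed through uniqueness
  of two-sided inverses; this rule turns each later formula for an inverse into a check of two
  composites.\<close>

lemma inv_arr_eqI:
  assumes f: "f \<in> Hom C X Y" and g: "g \<in> Hom C Y X" "g \<cdot> f = Ide C X" "f \<cdot> g = Ide C Y"
  shows "inv_arr C f = g"
proof -
  have "g' = g" if "is_inverse C f g'" for g'
  proof -
    have g': "g' \<in> Hom C Y X" "g' \<cdot> f = Ide C X"
      using that by (auto simp: is_inverse_iff[OF f])
    have "g' = g' \<cdot> (f \<cdot> g)" using g(3) cmp_ide[OF g'(1)] by simp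
    also have "\<dots> = (g' \<cdot> f) \<cdot> g" using cmp_assoc[OF g(1) f g'(1)] by simp
    also have "\<dots> = g" using g'(2) ide_cmp[OF g(1)] by simp
    finally show ?thesis .
  qed
  moreover have "is_inverse C f g" using g by (simp add: is_inverse_iff[OF f])
  ultimately show ?thesis unfolding inv_arr_def by (intro the_equality)
qed

lemma inv_arr:
  assumes f: "f \<in> Hom C X Y" and "is_iso C f"
  shows "inv_arr C f \<in> Hom C Y X" "inv_arr C f \<cdot> f = Ide C X" "f \<cdot> inv_arr C f = Ide C Y"
proof -
  obtain g where "is_inverse C f g" using assms(2) by (auto simp: is_iso_def)
  with f have g: "g \<in> Hom C Y X" "g \<cdot> f = Ide C X" "f \<cdot> g = Ide C Y"
    by (auto simp: is_inverse_iff)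
  with inv_arr_eqI[OF f g]
  show "inv_arr C f \<in> Hom C Y X" "inv_arr C f \<cdot> f = Ide C X" "f \<cdot> inv_arr C f = Ide C Y"
    by auto
qed

lemma is_isoI:
  assumes "f \<in> Hom C X Y" "g \<in> Hom C Y X" "g \<cdot> f = Ide C X" "f \<cdot> g = Ide C Y"
  shows "is_iso C f"
  using assms by (auto simp: is_iso_def is_inverse_iff)

lemma inv_cancel_left:
  assumes f: "f \<in> Hom C X Y" "is_iso C f"
  shows "g \<in> Hom C W X \<Longrightarrow> inv_arr C f \<cdot> (f \<cdot> g) = g"
    and "h \<in> Hom C W Y \<Longrightarrow> f \<cdot> (inv_arr C f \<cdot> h) = h"
proof -
  note f' = inv_arr[OF f]
  show "inv_arr C f \<cdot> (f \<cdot> g) = g" if g: "g \<in> Hom C W X"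
    using cmp_assoc[OF g f(1) f'(1)] ide_cmp[OF g] f'(2) by simp
  show "f \<cdot> (inv_arr C f \<cdot> h) = h" if h: "h \<in> Hom C W Y"
    using cmp_assoc[OF h f'(1) f(1)] ide_cmp[OF h] f'(3) by simp
qed

lemma ide_iso: "X \<in> Obj C \<Longrightarrow> is_iso C (Ide C X)"
  using is_isoI[OF ide_in ide_in] cmp_ide[OF ide_in] by blast

lemma cmp_inverse:
  assumes f: "f \<in> Hom C X Y" "is_iso C f" and g: "g \<in> Hom C Y Z" "is_iso C g"
  shows "is_iso C (g \<cdot> f)" "inv_arr C (g \<cdot> f) = inv_arr C f \<cdot> inv_arr C g"
proof -
  note f' = inv_arr[OF f] and g' = inv_arr[OF g]
  have gf: "g \<cdot> f \<in> Hom C X Z" and fg: "inv_arr C f \<cdot> inv_arr C g \<in> Hom C Z X"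
    using cmp_in f(1) g(1) f'(1) g'(1) by blast+
  have l: "(inv_arr C f \<cdot> inv_arr C g) \<cdot> (g \<cdot> f) = Ide C X"
    using cmp_assoc[OF gf g'(1) f'(1)] inv_cancel_left(1)[OF g f(1)] f'(2) by simp
  have r: "(g \<cdot> f) \<cdot> (inv_arr C f \<cdot> inv_arr C g) = Ide C Z"
    using cmp_assoc[OF fg f(1) g(1)] inv_cancel_left(2)[OF f g'(1)] g'(3) by simp
  show "is_iso C (g \<cdot> f)" by (rule is_isoI[OF gf fg l r])
  show "inv_arr C (g \<cdot> f) = inv_arr C f \<cdot> inv_arr C g" by (rule inv_arr_eqI[OF gf fg l r])
qed

lemma ide_functor: "is_functor C C id_fctr"
  by unfold_locales (auto simp: id_fctr_def)

end

section \<open>Zero arrows, zero objects, kernels and cokernels in a linear category\<close>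

context linear_category
begin

text \<open>Cancelling an additive inverse of \<open>f\<close> gives this. Composition, tensor
  product and exact functors are assumed additive but not explicitly zero preserving; this rule
  supplies the latter each time.\<close>

lemma add_self_zer:
  assumes f: "f \<in> Hom C X Y" and "f \<oplus> f = f"
  shows "f = Zer C X Y"
proof -
  obtain g where g: "g \<in> Hom C X Y" "f \<oplus> g = Zer C X Y" using add_neg[OF f] by blast
  then show ?thesis using add_assoc[OF f f g(1)] assms(2) add_zer[OF f] by simp
qed

lemma cmp_zer:
  assumes "f \<in> Hom C X Y" "W \<in> Obj C"
  shows "f \<cdot> Zer C W X = Zer C W Y"
proof (rule add_self_zer)
  have z: "Zer C W X \<in> Hom C W X" using zer_in assms Hom_objD by blast
  show "f \<cdot> Zer C W X \<in> Hom C W Y" using cmp_in[OF z assms(1)] .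
  show "f \<cdot> Zer C W X \<oplus> f \<cdot> Zer C W X = f \<cdot> Zer C W X"
    using cmp_add_right[OF z z assms(1)] add_zer[OF z] by simp
qed

lemma zer_cmp:
  assumes "f \<in> Hom C X Y" "Z \<in> Obj C"
  shows "Zer C Y Z \<cdot> f = Zer C X Z"
proof (rule add_self_zer)
  have z: "Zer C Y Z \<in> Hom C Y Z" using zer_in assms Hom_objD by blast
  show "Zer C Y Z \<cdot> f \<in> Hom C X Z" using cmp_in[OF assms(1) z] .
  show "Zer C Y Z \<cdot> f \<oplus> Zer C Y Z \<cdot> f = Zer C Y Z \<cdot> f"
    using cmp_add_left[OF assms(1) z z] add_zer[OF z] by simp
qed

text \<open>Turns two universal properties into one equation between arrows, which additive functors
  and the tensor product visibly transport. If the identity is a zero arrow, composing with it shows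
  that every arrow into or out of \<open>Z\<close> is zero.\<close>

lemma is_zero_iff: "is_zero C Z \<longleftrightarrow> Z \<in> Obj C \<and> Ide C Z = Zer C Z Z"
proof
  assume "is_zero C Z"
  then show "Z \<in> Obj C \<and> Ide C Z = Zer C Z Z"
    using ide_in zer_in unfolding is_zero_def is_initial_def by blast
next
  assume Z: "Z \<in> Obj C \<and> Ide C Z = Zer C Z Z"
  have "f = Zer C Z X" if "f \<in> Hom C Z X" for f X
    using that Z cmp_ide[OF that] cmp_zer[OF that] by simp
  moreover have "f = Zer C X Z" if "f \<in> Hom C X Z" for f X
    using that Z ide_cmp[OF that] zer_cmp[OF that] by simp
  ultimately show "is_zero C Z"
    unfolding is_zero_def is_initial_def is_terminal_def using Z zer_in by blast
qed

lemma is_zero_hom_from: "is_zero C Z \<Longrightarrow> f \<in> Hom C Z X \<Longrightarrow> f = Zer C Z X"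
  using zer_in Hom_objD unfolding is_zero_def is_initial_def by blast

lemma is_zero_hom_to: "is_zero C Z \<Longrightarrow> f \<in> Hom C X Z \<Longrightarrow> f = Zer C X Z"
  using zer_in Hom_objD unfolding is_zero_def is_terminal_def by blast

lemma is_zero_retract:
  assumes "is_zero C X" "f \<in> Hom C X Y" "g \<in> Hom C Y X" "f \<cdot> g = Ide C Y"
  shows "is_zero C Y"
proof -
  have "g = Zer C Y X" using is_zero_hom_to assms by blast
  then show ?thesis using assms cmp_zer[OF assms(2)] Hom_objD[OF assms(2)] is_zero_iff by auto
qed

lemma is_zero_iso:
  assumes "f \<in> Hom C X Y" "is_iso C f"
  shows "is_zero C X \<longleftrightarrow> is_zero C Y"
  using is_zero_retract[OF _ assms(1) inv_arr(1,3)[OF assms]]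
    is_zero_retract[OF _ inv_arr(1)[OF assms] assms(1) inv_arr(2)[OF assms]] by blast

lemma kernelD:
  assumes "is_kernel C f k"
  shows "f \<in> Hom C (Dom C f) (Cod C f)" "k \<in> Hom C (Dom C k) (Dom C f)" "Cod C k = Dom C f"
    "f \<cdot> k = Zer C (Dom C k) (Cod C f)"
    "h \<in> Hom C W (Dom C f) \<Longrightarrow> f \<cdot> h = Zer C W (Cod C f) \<Longrightarrow> \<exists>u \<in> Hom C W (Dom C k). k \<cdot> u = h"
proof -
  show "f \<in> Hom C (Dom C f) (Cod C f)" "k \<in> Hom C (Dom C k) (Dom C f)" "Cod C k = Dom C f"
    "f \<cdot> k = Zer C (Dom C k) (Cod C f)"
    using assms unfolding is_kernel_def Hom_def by simp_all
  show "\<exists>u \<in> Hom C W (Dom C k). k \<cdot> u = h" if "h \<in> Hom C W (Dom C f)" "f \<cdot> h = Zer C W (Cod C f)"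
    using assms that unfolding is_kernel_def by blast
qed

lemma cokernelD:
  assumes "is_cokernel C f c"
  shows "f \<in> Hom C (Dom C f) (Cod C f)" "c \<in> Hom C (Cod C f) (Cod C c)" "Dom C c = Cod C f"
    "c \<cdot> f = Zer C (Dom C f) (Cod C c)"
    "h \<in> Hom C (Cod C f) W \<Longrightarrow> h \<cdot> f = Zer C (Dom C f) W \<Longrightarrow> \<exists>u \<in> Hom C (Cod C c) W. u \<cdot> c = h"
proof -
  show "f \<in> Hom C (Dom C f) (Cod C f)" "c \<in> Hom C (Cod C f) (Cod C c)" "Dom C c = Cod C f"
    "c \<cdot> f = Zer C (Dom C f) (Cod C c)"
    using assms unfolding is_cokernel_def Hom_def by simp_all
  show "\<exists>u \<in> Hom C (Cod C c) W. u \<cdot> c = h" if "h \<in> Hom C (Cod C f) W" "h \<cdot> f = Zer C (Dom C f) W"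
    using assms that unfolding is_cokernel_def by blast
qed

text \<open>The uniqueness clause of the universal property, applied to \<open>k \<cdot> h\<close>,
  which \<open>f\<close> kills because it kills \<open>k\<close>.\<close>

lemma kernel_monic: 
  assumes k: "is_kernel C f k"
  shows "monic C k"
  unfolding monic_def
proof (intro conjI allI ballI impI)
  show "k \<in> Arr C" using kernelD(2)[OF k] in_HomD by metis
  fix W g h assume g: "g \<in> Hom C W (Dom C k)" and h: "h \<in> Hom C W (Dom C k)" and e: "k \<cdot> g = k \<cdot> h"
  note k' = kernelD[OF k]
  have "k \<cdot> h \<in> Hom C W (Dom C f)" using cmp_in[OF h k'(2)] .
  moreover have "f \<cdot> (k \<cdot> h) = Zer C W (Cod C f)"
    using cmp_assoc[OF h k'(2) k'(1)] k'(4) zer_cmp[OF h] Hom_objD[OF k'(1)] by simp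
  ultimately have "\<exists>!u. u \<in> Hom C W (Dom C k) \<and> k \<cdot> u = k \<cdot> h"
    using k unfolding is_kernel_def by blast
  then show "g = h" using g h e by blast
qed

lemma cokernel_epic: 
  assumes c: "is_cokernel C f c"
  shows "epic C c"
  unfolding epic_def
proof (intro conjI allI ballI impI)
  show "c \<in> Arr C" using cokernelD(2)[OF c] in_HomD by metis
  note c' = cokernelD[OF c]
  fix W g h assume g: "g \<in> Hom C (Cod C c) W" and h: "h \<in> Hom C (Cod C c) W" and e: "g \<cdot> c = h \<cdot> c"
  have "h \<cdot> c \<in> Hom C (Cod C f) W" using cmp_in[OF c'(2) h] .
  moreover have "(h \<cdot> c) \<cdot> f = Zer C (Dom C f) W"
    using cmp_assoc[OF c'(1) c'(2) h] c'(4) cmp_zer[OF h] Hom_objD[OF c'(1)] by simp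
  ultimately have "\<exists>!u. u \<in> Hom C (Cod C c) W \<and> u \<cdot> c = h \<cdot> c"
    using c unfolding is_cokernel_def by blast
  then show "g = h" using g h e by blast
qed

lemma is_zero_monic:
  assumes f: "f \<in> Hom C X Y" "monic C f" and Y: "is_zero C Y"
  shows "is_zero C X"
proof -
  have X: "X \<in> Obj C" using Hom_objD[OF f(1)] by blast
  have "f \<cdot> Ide C X = f \<cdot> Zer C X X"
    using is_zero_hom_to[OF Y f(1)] cmp_ide[OF f(1)] cmp_zer[OF f(1) X] by simp
  then have "Ide C X = Zer C X X"
    using f in_HomD[OF f(1)] ide_in[OF X] zer_in[OF X X] unfolding monic_def by blast
  then show ?thesis using X is_zero_iff by blast
qed

lemma is_zero_epic:
  assumes f: "f \<in> Hom C X Y" "epic C f" and X: "is_zero C X"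
  shows "is_zero C Y"
proof -
  have Y: "Y \<in> Obj C" using Hom_objD[OF f(1)] by blast
  have "Ide C Y \<cdot> f = Zer C Y Y \<cdot> f"
    using is_zero_hom_from[OF X f(1)] ide_cmp[OF f(1)] zer_cmp[OF f(1) Y] by simp
  then have "Ide C Y = Zer C Y Y"
    using f in_HomD[OF f(1)] ide_in[OF Y] zer_in[OF Y Y] unfolding epic_def by blast
  then show ?thesis using Y is_zero_iff by blast
qed

text \<open>For \<open>X\<close> in a Serre ideal this exhibits the inclusion of zero in
  \<open>X\<close> as one of the monomorphisms that the quotient inverts, its cokernel being
  \<open>X\<close> itself.\<close>

lemma ide_cokernel_from_zero:
  assumes "X \<in> Obj C" "is_zero C Z"
  shows "is_cokernel C (Zer C Z X) (Ide C X)"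
proof -
  have Z: "Z \<in> Obj C" using assms is_zero_iff by blast
  have i: "Ide C X \<in> Hom C X X" and z: "Zer C Z X \<in> Hom C Z X" using assms ide_in zer_in Z by blast+
  show ?thesis unfolding is_cokernel_def
    using in_HomD[OF i] in_HomD[OF z] i ide_cmp[OF z] cmp_ide by auto
qed

lemma from_zero_monic:
  assumes X: "X \<in> Obj C" and Z: "is_zero C Z"
  shows "monic C (Zer C Z X)"
proof -
  have "Zer C Z X \<in> Hom C Z X" using X Z zer_in is_zero_iff by blast
  then show ?thesis
    using in_HomD[of "Zer C Z X" C Z X] is_zero_hom_to[OF Z] unfolding monic_def by metis
qed

lemma ide_monic: "X \<in> Obj C \<Longrightarrow> monic C (Ide C X)"
  using in_HomD[OF ide_in, of X] ide_cmp unfolding monic_def by metis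

lemma ide_epic: "X \<in> Obj C \<Longrightarrow> epic C (Ide C X)"
  using in_HomD[OF ide_in, of X] cmp_ide unfolding epic_def by metis

text \<open>Together with its dual below, this makes \<open>Ide C X\<close> admissible as either leg
  of a roof: its kernel and cokernel are zero objects, which lie in every Serre ideal.\<close>

lemma zero_kernel_of_ide:
  assumes X: "X \<in> Obj C" and Z: "is_zero C Z"
  shows "is_kernel C (Ide C X) (Zer C Z X)"
proof -
  have Zo: "Z \<in> Obj C" using Z is_zero_iff by blast
  have i: "Ide C X \<in> Hom C X X" and z: "Zer C Z X \<in> Hom C Z X" using X ide_in zer_in Zo by blast+
  have "\<exists>!u. u \<in> Hom C W Z \<and> Zer C Z X \<cdot> u = h"
    if h: "h \<in> Hom C W X" "Ide C X \<cdot> h = Zer C W X" for W h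
  proof (rule ex1I)
    have W: "W \<in> Obj C" using Hom_objD[OF h(1)] by blast
    have "Zer C Z X \<cdot> Zer C W Z = h" using cmp_zer[OF z W] h ide_cmp[OF h(1)] by simp
    then show "Zer C W Z \<in> Hom C W Z \<and> Zer C Z X \<cdot> Zer C W Z = h" using zer_in[OF W Zo] by blast
  qed (use is_zero_hom_to[OF Z] in blast)
  then show ?thesis unfolding is_kernel_def
    using in_HomD[OF i] in_HomD[OF z] z ide_cmp[OF z] by auto
qed

lemma zero_cokernel_of_ide:
  assumes X: "X \<in> Obj C" and Z: "is_zero C Z"
  shows "is_cokernel C (Ide C X) (Zer C X Z)"
proof -
  have Zo: "Z \<in> Obj C" using Z is_zero_iff by blast
  have i: "Ide C X \<in> Hom C X X" and z: "Zer C X Z \<in> Hom C X Z" using X ide_in zer_in Zo by blast+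
  have "\<exists>!u. u \<in> Hom C Z W \<and> u \<cdot> Zer C X Z = h"
    if h: "h \<in> Hom C X W" "h \<cdot> Ide C X = Zer C X W" for W h
  proof (rule ex1I)
    have W: "W \<in> Obj C" using Hom_objD[OF h(1)] by blast
    have "Zer C Z W \<cdot> Zer C X Z = h" using zer_cmp[OF z W] h cmp_ide[OF h(1)] by simp
    then show "Zer C Z W \<in> Hom C Z W \<and> Zer C Z W \<cdot> Zer C X Z = h" using zer_in[OF Zo W] by blast
  qed (use is_zero_hom_from[OF Z] in blast)
  then show ?thesis unfolding is_cokernel_def
    using in_HomD[OF i] in_HomD[OF z] z cmp_ide[OF z] by auto
qed

end

text \<open>A monomorphism is the kernel of some \<open>g\<close>. As \<open>g\<close> kills
  \<open>s\<close>, it factors through \<open>c\<close>, so whatever \<open>c\<close> kills is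
  killed by \<open>g\<close> and factors uniquely through \<open>s\<close>. A monomorphism and its
  cokernel thus form a short exact sequence, to which the ideal condition applies.\<close>

lemma (in abelian_category) kernel_of_cokernel:
  assumes "monic C s" and c: "is_cokernel C s c"
  shows "is_kernel C c s"
proof -
  obtain g where g: "is_kernel C g s" using monic_normal assms(1) by blast
  note c' = cokernelD[OF c] and g' = kernelD[OF g]
  have s: "s \<in> Hom C (Dom C s) (Dom C c)" using c'(1,3) by simp
  have cc: "c \<in> Hom C (Dom C c) (Cod C c)" using c'(2,3) by simp
  obtain u where u: "u \<in> Hom C (Cod C c) (Cod C g)" "u \<cdot> c = g"
    using c'(5)[of g "Cod C g"] g' by auto
  have "\<exists>!v. v \<in> Hom C W (Dom C s) \<and> s \<cdot> v = h"
    if h: "h \<in> Hom C W (Dom C c)" "c \<cdot> h = Zer C W (Cod C c)" for W h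
  proof -
    have "g \<cdot> h = Zer C W (Cod C g)"
      using cmp_assoc[OF h(1) cc u(1)] u(2) h(2) cmp_zer[OF u(1)] Hom_objD[OF h(1)] by simp
    then show ?thesis using g h(1) c'(3) g'(3) unfolding is_kernel_def by auto
  qed
  then show ?thesis unfolding is_kernel_def using s c'(4) in_HomD[OF cc] by blast
qed

section \<open>Tensor products with zero arrows and zero objects\<close>

context ex_tensor_category
begin

lemma zer_ten:
  assumes g: "g \<in> Hom C Y Y'" and X: "X \<in> Obj C" "X' \<in> Obj C"
  shows "Zer C X X' \<otimes> g = Zer C (X \<odot> Y) (X' \<odot> Y')"
proof (rule add_self_zer)
  have z: "Zer C X X' \<in> Hom C X X'" using zer_in X by blast
  show "Zer C X X' \<otimes> g \<in> Hom C (X \<odot> Y) (X' \<odot> Y')" using tenA_in[OF z g] .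
  show "Zer C X X' \<otimes> g \<oplus> Zer C X X' \<otimes> g = Zer C X X' \<otimes> g"
    using ten_add_left[OF z z g] add_zer[OF z] by simp
qed

lemma ten_zer:
  assumes g: "g \<in> Hom C Y Y'" and X: "X \<in> Obj C" "X' \<in> Obj C"
  shows "g \<otimes> Zer C X X' = Zer C (Y \<odot> X) (Y' \<odot> X')"
proof (rule add_self_zer)
  have z: "Zer C X X' \<in> Hom C X X'" using zer_in X by blast
  show "g \<otimes> Zer C X X' \<in> Hom C (Y \<odot> X) (Y' \<odot> X')" using tenA_in[OF g z] .
  show "g \<otimes> Zer C X X' \<oplus> g \<otimes> Zer C X X' = g \<otimes> Zer C X X'"
    using ten_add_right[OF g z z] add_zer[OF z] by simp
qed

text \<open>The tensor product of a zero arrow with any arrow is zero by bilinearity; this is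
  applied to \<open>Ide C X \<otimes> Ide C Y\<close>, the identity of the product.\<close>

lemma is_zero_ten:
  assumes X: "is_zero C X" and Y: "Y \<in> Obj C"
  shows "is_zero C (X \<odot> Y)" "is_zero C (Y \<odot> X)"
proof -
  have X': "X \<in> Obj C" "Ide C X = Zer C X X" using X by (simp_all add: is_zero_iff)
  show "is_zero C (X \<odot> Y)"
    using tenO_in[OF X'(1) Y] ten_ide[OF X'(1) Y] zer_ten[OF ide_in[OF Y] X'(1) X'(1)] X'(2)
    by (simp add: is_zero_iff)
  show "is_zero C (Y \<odot> X)"
    using tenO_in[OF Y X'(1)] ten_ide[OF Y X'(1)] ten_zer[OF ide_in[OF Y] X'(1) X'(1)] X'(2)
    by (simp add: is_zero_iff)
qed

end

section \<open>Exact functors and their kernels\<close>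

context is_functor
begin

lemma fa_iso:
  assumes f: "f \<in> Hom A X Y" "is_iso A f"
  shows "is_iso B (FA F f)" "inv_arr B (FA F f) = FA F (inv_arr A f)"
proof -
  note f' = A.inv_arr[OF f]
  have XY: "X \<in> Obj A" "Y \<in> Obj A" using A.Hom_objD[OF f(1)] by auto
  note Ff = fa_in[OF f(1)] and Ff' = fa_in[OF f'(1)]
  have 1: "FA F (inv_arr A f) \<cdot>\<^bsub>B\<^esub> FA F f = Ide B (FO F X)"
    using fa_cmp[OF f(1) f'(1)] f'(2) fa_ide[OF XY(1)] by simp
  have 2: "FA F f \<cdot>\<^bsub>B\<^esub> FA F (inv_arr A f) = Ide B (FO F Y)"
    using fa_cmp[OF f'(1) f(1)] f'(3) fa_ide[OF XY(2)] by simp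
  show "is_iso B (FA F f)" by (rule B.is_isoI[OF Ff Ff' 1 2])
  show "inv_arr B (FA F f) = FA F (inv_arr A f)" by (rule B.inv_arr_eqI[OF Ff Ff' 1 2])
qed

end

text \<open>Classifying and induced functors are determined only up to isomorphism; this makes their
  kernels well defined.\<close>

lemma natural_iso_Ker:
  assumes "linear_category B" "natural_iso A B F G \<theta>"
  shows "Ker A B F = Ker A B G"
proof -
  interpret B: linear_category B by fact
  have "is_zero B (FO F X) \<longleftrightarrow> is_zero B (FO G X)" if "X \<in> Obj A" for X
    using B.is_zero_iso[of "\<theta> X" "FO F X" "FO G X"] assms(2) that unfolding natural_iso_def by blast
  then show ?thesis by (auto simp: Ker_def)
qed

context exact_tensor_functor
begin

lemma fa_zer:
  assumes "X \<in> Obj A" "Y \<in> Obj A"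
  shows "FA F (Zer A X Y) = Zer B (FO F X) (FO F Y)"
proof (rule B.add_self_zer)
  have z: "Zer A X Y \<in> Hom A X Y" using A.zer_in assms by blast
  show "FA F (Zer A X Y) \<in> Hom B (FO F X) (FO F Y)" using fa_in[OF z] .
  show "FA F (Zer A X Y) \<oplus>\<^bsub>B\<^esub> FA F (Zer A X Y) = FA F (Zer A X Y)"
    using fa_add[OF z z] A.add_zer[OF z] by simp
qed

lemma fo_zero: "is_zero A X \<Longrightarrow> is_zero B (FO F X)"
  using fo_in[of X] fa_ide[of X] fa_zer[of X X] by (simp add: A.is_zero_iff B.is_zero_iff)

text \<open>The substantial direction passes through the coimage. If \<open>F\<close> kills
  \<open>f\<close>, it also kills the cokernel object of the kernel of \<open>f\<close>; that object
  is then zero, and \<open>f\<close> factors through it. Differences of parallel arrows reduce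
  faithfulness to this case.\<close>

lemma faithful_iff: "faithful A F \<longleftrightarrow> (\<forall>X \<in> Ker A B F. is_zero A X)"
proof
  assume faith: "faithful A F"
  show "\<forall>X \<in> Ker A B F. is_zero A X"
  proof
    fix X assume "X \<in> Ker A B F"
    then have X: "X \<in> Obj A" "is_zero B (FO F X)" by (auto simp: Ker_def)
    then have "FA F (Ide A X) = FA F (Zer A X X)"
      using fa_ide fa_zer by (simp add: B.is_zero_iff)
    then have "Ide A X = Zer A X X"
      using faith A.ide_in[OF X(1)] A.zer_in[OF X(1) X(1)] unfolding faithful_def inj_on_def by blast
    then show "is_zero A X" using X by (simp add: A.is_zero_iff)
  qed
next
  assume R: "\<forall>X \<in> Ker A B F. is_zero A X"
  have kill: "f = Zer A X Y" if f: "f \<in> Hom A X Y" "FA F f = Zer B (FO F X) (FO F Y)" for f X Y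
  proof -
    have XY: "X \<in> Obj A" "Y \<in> Obj A" using A.Hom_objD[OF f(1)] by auto
    have fA: "f \<in> Arr A" "Dom A f = X" "Cod A f = Y" using in_HomD[OF f(1)] by auto
    obtain k where k: "is_kernel A f k" using A.kernel fA(1) by blast
    note k' = A.kernelD[OF k]
    have kA: "k \<in> Arr A" using in_HomD[OF k'(2)] by blast
    obtain c where c: "is_cokernel A k c" using A.cokernel[OF kA] by blast
    note c' = A.cokernelD[OF c]
    have Fk: "FA F k \<in> Hom B (FO F (Dom A k)) (FO F X)" using fa_in[OF k'(2)] fA by simp
    have Fc: "FA F c \<in> Hom B (FO F X) (FO F (Cod A c))" using fa_in[OF c'(2)] k'(3) fA by simp
    have FX: "FO F X \<in> Obj B" using fo_in XY by blast
    \<comment> \<open>Since \<open>FA F f\<close> is zero and \<open>FA F k\<close> is its kernel,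
      the identity factors through \<open>FA F k\<close>, which is thereby split epic.\<close>
    obtain u where u: "u \<in> Hom B (FO F X) (FO F (Dom A k))" "FA F k \<cdot>\<^bsub>B\<^esub> u = Ide B (FO F X)"
    proof -
      have "\<exists>u \<in> Hom B (FO F X) (Dom B (FA F k)). FA F k \<cdot>\<^bsub>B\<^esub> u = Ide B (FO F X)"
        using B.kernelD(5)[OF fa_kernel[OF k], of "Ide B (FO F X)" "FO F X"]
          in_HomD[OF fa_in[OF f(1)]] B.ide_in[OF FX] B.cmp_ide[OF fa_in[OF f(1)]] f(2) by simp
      then show ?thesis using that in_HomD[OF Fk] by auto
    qed
    \<comment> \<open>\<open>FA F c\<close> kills \<open>FA F k\<close>, so composing with the
      section \<open>u\<close> shows that it is zero; being epic, it has a zero codomain.\<close>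
    have "FA F c = (FA F c \<cdot>\<^bsub>B\<^esub> FA F k) \<cdot>\<^bsub>B\<^esub> u"
      using B.cmp_assoc[OF u(1) Fk Fc] u(2) B.cmp_ide[OF Fc] by simp
    also have "FA F c \<cdot>\<^bsub>B\<^esub> FA F k = Zer B (FO F (Dom A k)) (FO F (Cod A c))"
      using fa_cmp[OF k'(2), of c "Cod A c"] c'(2,4) k'(3) fA
        fa_zer[of "Dom A k" "Cod A c"] A.Hom_objD[OF k'(2)] A.Hom_objD[OF c'(2)] by simp
    also have "\<dots> \<cdot>\<^bsub>B\<^esub> u = Zer B (FO F X) (FO F (Cod A c))"
      using B.zer_cmp[OF u(1)] B.Hom_objD[OF Fc] by blast
    finally have "FA F c = Zer B (FO F X) (FO F (Cod A c))" .
    moreover have "epic B (FA F c)" by (rule B.cokernel_epic[OF fa_cokernel[OF c]])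
    moreover have FC: "FO F (Cod A c) \<in> Obj B" using B.Hom_objD[OF Fc] by blast
    ultimately have "Ide B (FO F (Cod A c)) = Zer B (FO F (Cod A c)) (FO F (Cod A c))"
      using in_HomD[OF Fc] B.ide_cmp[OF Fc] B.zer_cmp[OF Fc FC] B.ide_in[OF FC] B.zer_in[OF FC FC]
      unfolding epic_def by metis
    then have "Cod A c \<in> Ker A B F" using FC A.Hom_objD[OF c'(2)] B.is_zero_iff by (simp add: Ker_def)
    then have Z: "is_zero A (Cod A c)" using R by blast
    have cX: "c \<in> Hom A X (Cod A c)" using c'(2) k'(3) fA by simp
    have "f \<cdot>\<^bsub>A\<^esub> k = Zer A (Dom A k) Y" using k'(4) fA by simp
    then obtain v where v: "v \<in> Hom A (Cod A c) Y" "v \<cdot>\<^bsub>A\<^esub> c = f"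
      using c'(5)[of f Y] f(1) k'(3) fA by auto
    show ?thesis using v(2) A.is_zero_hom_from[OF Z v(1)] A.zer_cmp[OF cX XY(2)] by simp
  qed
  show "faithful A F"
    unfolding faithful_def
  proof (intro allI inj_onI)
    fix X Y f g assume f: "f \<in> Hom A X Y" and g: "g \<in> Hom A X Y" and e: "FA F f = FA F g"
    \<comment> \<open>\<open>n\<close> is minus \<open>g\<close>, so \<open>f \<oplus> n\<close> is
      the difference of the two arrows.\<close>
    obtain n where n: "n \<in> Hom A X Y" "g \<oplus>\<^bsub>A\<^esub> n = Zer A X Y" using A.add_neg[OF g] by blast
    have XY: "X \<in> Obj A" "Y \<in> Obj A" using A.Hom_objD[OF f] by auto
    have "FA F (f \<oplus>\<^bsub>A\<^esub> n) = Zer B (FO F X) (FO F Y)"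
      using fa_add[OF f n(1)] fa_add[OF g n(1)] e n(2) fa_zer[OF XY] by simp
    then have fn: "f \<oplus>\<^bsub>A\<^esub> n = Zer A X Y" using kill A.add_in[OF f n(1)] by blast
    have "f = f \<oplus>\<^bsub>A\<^esub> (n \<oplus>\<^bsub>A\<^esub> g)" using A.add_zer[OF f] n A.add_comm[OF g n(1)] by simp
    also have "\<dots> = Zer A X Y \<oplus>\<^bsub>A\<^esub> g" using A.add_assoc[OF f n(1) g] fn by simp
    also have "\<dots> = g" using A.add_comm[OF A.zer_in[OF XY] g] A.add_zer[OF g] by simp
    finally show "f = g" .
  qed
qed

lemma Ker_serre_tensor_ideal: "serre_tensor_ideal A (Ker A B F)"
  unfolding serre_tensor_ideal_def
proof (intro conjI allI impI ballI)
  show "Ker A B F \<subseteq> Obj A" by (auto simp: Ker_def)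
  show "Z \<in> Ker A B F" if "is_zero A Z" for Z
    using fo_zero[OF that] that by (simp add: Ker_def A.is_zero_iff)
  show "Cod A f \<in> Ker A B F \<longleftrightarrow> Dom A f \<in> Ker A B F \<and> Cod A g \<in> Ker A B F" if fg: "short_exact A f g" for f g
  proof -
    have k: "is_kernel A g f" and c: "is_cokernel A f g" using fg by (simp_all add: short_exact_def)
    note k' = A.kernelD[OF k] and c' = A.cokernelD[OF c]
    note Fk = fa_kernel[OF k] and Fc = fa_cokernel[OF c]
    note f = c'(1) and g = c'(2)
    note Ff = fa_in[OF f] and Fg = fa_in[OF g]
    note o = A.Hom_objD[OF f] A.Hom_objD[OF g]
    \<comment> \<open>Closure under extensions: with \<open>FO F (Cod A g)\<close> zero,
      \<open>FA F f\<close> is the kernel of a zero arrow, so the identity of the middle term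
      factors through \<open>FO F (Dom A f)\<close>, which is zero too.\<close>
    have "is_zero B (FO F (Cod A f))"
      if z: "is_zero B (FO F (Dom A f))" "is_zero B (FO F (Cod A g))"
    proof -
      have i: "Ide B (FO F (Cod A f)) \<in> Hom B (FO F (Cod A f)) (FO F (Cod A f))"
        using B.ide_in fo_in o by blast
      have "FA F g \<cdot>\<^bsub>B\<^esub> Ide B (FO F (Cod A f)) = Zer B (FO F (Cod A f)) (FO F (Cod A g))"
        using B.is_zero_hom_to[OF z(2) Fg] B.cmp_ide[OF Fg] by simp
      then obtain u where "u \<in> Hom B (FO F (Cod A f)) (FO F (Dom A f))"
          "FA F f \<cdot>\<^bsub>B\<^esub> u = Ide B (FO F (Cod A f))"
        using B.kernelD(5)[OF Fk, of "Ide B (FO F (Cod A f))" "FO F (Cod A f)"] i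
          in_HomD[OF Ff] in_HomD[OF Fg] by auto
      then show ?thesis using B.is_zero_retract[OF z(1) Ff] by blast
    qed
    then show ?thesis
      using B.is_zero_monic[OF Ff B.kernel_monic[OF Fk]] B.is_zero_epic[OF Fg B.cokernel_epic[OF Fc]] o
      unfolding Ker_def by blast
  qed
  fix X Y assume "X \<in> Ker A B F" and Y: "Y \<in> Obj A"
  then have X: "X \<in> Obj A" "is_zero B (FO F X)" by (auto simp: Ker_def)
  \<comment> \<open>\<open>FMu\<close> identifies the image of a product with the product of the
    images, one factor of which is zero.\<close>
  note z = B.is_zero_ten[OF X(2) fo_in[OF Y]]
  show "X \<odot>\<^bsub>A\<^esub> Y \<in> Ker A B F"
    using z(1) B.is_zero_iso mu_in[OF X(1) Y] A.tenO_in[OF X(1) Y] unfolding Ker_def by blast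
  show "Y \<odot>\<^bsub>A\<^esub> X \<in> Ker A B F"
    using z(2) B.is_zero_iso mu_in[OF Y X(1)] A.tenO_in[OF Y X(1)] unfolding Ker_def by blast
qed

end

text \<open>For empty \<open>S\<close> the two sides differ in general: the joint kernel is
  \<open>Obj A\<close>, while an intersection over the empty index set is the universal set.\<close>

lemma joint_Ker_eq: "S \<noteq> {} \<Longrightarrow> joint_Ker A S F = (\<Inter>h \<in> S. Ker A (fst h) (F h))"
  by (auto simp: joint_Ker_def Ker_def)

lemma serre_tensor_ideal_INT:
  assumes "I \<noteq> {}" "\<And>i. i \<in> I \<Longrightarrow> serre_tensor_ideal A (K i)"
  shows "serre_tensor_ideal A (\<Inter>i \<in> I. K i)"
  unfolding serre_tensor_ideal_def
proof (intro conjI allI impI ballI)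
  have K: "K i \<subseteq> Obj A" "is_zero A Z \<Longrightarrow> Z \<in> K i"
    "short_exact A f g \<Longrightarrow> Cod A f \<in> K i \<longleftrightarrow> Dom A f \<in> K i \<and> Cod A g \<in> K i"
    "X \<in> K i \<Longrightarrow> Y \<in> Obj A \<Longrightarrow> X \<odot>\<^bsub>A\<^esub> Y \<in> K i \<and> Y \<odot>\<^bsub>A\<^esub> X \<in> K i" if "i \<in> I" for i Z f g X Y
    using assms(2)[OF that] unfolding serre_tensor_ideal_def by simp_all
  show "(\<Inter>i \<in> I. K i) \<subseteq> Obj A" using assms(1) K(1) by blast
  show "Z \<in> (\<Inter>i \<in> I. K i)" if "is_zero A Z" for Z using that K(2) by blast
  show "Cod A f \<in> (\<Inter>i \<in> I. K i) \<longleftrightarrow> Dom A f \<in> (\<Inter>i \<in> I. K i) \<and> Cod A g \<in> (\<Inter>i \<in> I. K i)"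
    if "short_exact A f g" for f g using K(3)[OF _ that] by blast
  show "X \<odot>\<^bsub>A\<^esub> Y \<in> (\<Inter>i \<in> I. K i)" "Y \<odot>\<^bsub>A\<^esub> X \<in> (\<Inter>i \<in> I. K i)"
    if "X \<in> (\<Inter>i \<in> I. K i)" "Y \<in> Obj A" for X Y using K(4) that by blast+
qed

lemma joint_Ker_serre_tensor_ideal:
  assumes "S \<noteq> {}" "\<And>h. h \<in> S \<Longrightarrow> exact_tensor_functor A (fst h) (F h)"
  shows "serre_tensor_ideal A (joint_Ker A S F)"
  unfolding joint_Ker_eq[OF assms(1)]
  by (intro serre_tensor_ideal_INT exact_tensor_functor.Ker_serre_tensor_ideal assms)

section \<open>Serre quotients\<close>

lemma serre_quotientD:
  assumes "is_serre_quotient A K B Q"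
  shows "serre_tensor_ideal A K" "exact_tensor_functor A B Q" "Obj B = Obj A"
    "X \<in> Obj A \<Longrightarrow> FO Q X = X"
    "co_K_sub A K s \<Longrightarrow> is_iso B (FA Q s)" "K_quot A K t \<Longrightarrow> is_iso B (FA Q t)"
    "X \<in> Obj A \<Longrightarrow> Y \<in> Obj A \<Longrightarrow> g \<in> Hom B X Y \<Longrightarrow>
      \<exists>s f t. roof A K X Y s f t \<and> g = roof_arr B Q s f t"
    "roof A K X Y s f t \<Longrightarrow> roof A K X Y s' f' t' \<Longrightarrow>
      roof_arr B Q s f t = roof_arr B Q s' f' t' \<longleftrightarrow> roof_eq A K X Y s f t s' f' t'"
  using assms unfolding is_serre_quotient_def by blast+

text \<open>Objects of \<open>K\<close> die because the inclusion of zero in them is inverted.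
  Nothing else dies because an identity that vanishes in the quotient must already vanish in
  \<open>A\<close> after passing to a subobject with cokernel in \<open>K\<close> and a quotient
  with kernel in \<open>K\<close>.\<close>

lemma serre_quotient_Ker:
  assumes Q: "is_serre_quotient A K B Q"
  shows "Ker A B Q = K"
proof
  note Q' = serre_quotientD[OF Q]
  interpret Q: exact_tensor_functor A B Q by (rule Q'(2))
  have K: "K \<subseteq> Obj A" "\<And>Z. is_zero A Z \<Longrightarrow> Z \<in> K"
    "\<And>f g. short_exact A f g \<Longrightarrow> Cod A f \<in> K \<longleftrightarrow> Dom A f \<in> K \<and> Cod A g \<in> K"
    using Q'(1) unfolding serre_tensor_ideal_def by simp_all
  obtain Z where Z: "is_zero A Z" using Q.A.zero_object by blast
  then have Zo: "Z \<in> Obj A" by (simp add: Q.A.is_zero_iff)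
  show "K \<subseteq> Ker A B Q"
  proof
    fix X assume X: "X \<in> K"
    then have Xo: "X \<in> Obj A" using K(1) by blast
    have s: "Zer A Z X \<in> Hom A Z X" using Q.A.zer_in Xo Zo by blast
    have "co_K_sub A K (Zer A Z X)"
      using Q.A.from_zero_monic[OF Xo Z] Q.A.ide_cokernel_from_zero[OF Xo Z]
        in_HomD[OF Q.A.ide_in[OF Xo]] X unfolding co_K_sub_def by metis
    then have "is_zero B (FO Q X)"
      using Q'(5) Q.B.is_zero_iso[OF Q.fa_in[OF s]] Q.fo_zero[OF Z] by blast
    then show "X \<in> Ker A B Q" using Xo by (simp add: Ker_def)
  qed
  show "Ker A B Q \<subseteq> K"
  proof
    fix X assume "X \<in> Ker A B Q"
    then have X: "X \<in> Obj A" and QX: "is_zero B (FO Q X)" by (auto simp: Ker_def)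
    have i: "Ide A X \<in> Hom A X X" and z: "Zer A X X \<in> Hom A X X"
      using X Q.A.ide_in Q.A.zer_in by blast+
    note i' = in_HomD[OF i]
    have "co_K_sub A K (Ide A X)"
      using Q.A.ide_monic[OF X] Q.A.zero_cokernel_of_ide[OF X Z] in_HomD[OF Q.A.zer_in[OF X Zo]] K(2)[OF Z]
      unfolding co_K_sub_def by metis
    moreover have "K_quot A K (Ide A X)"
      using Q.A.ide_epic[OF X] Q.A.zero_kernel_of_ide[OF X Z] in_HomD[OF Q.A.zer_in[OF Zo X]] K(2)[OF Z]
      unfolding K_quot_def by metis
    \<comment> \<open>With both legs trivial, these roofs represent the identity and the zero
      endomorphism of \<open>X\<close>; their arrows in \<open>B\<close> agree because
      \<open>FO Q X\<close> is zero.\<close>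
    ultimately have roofs: "roof A K X X (Ide A X) (Ide A X) (Ide A X)" "roof A K X X (Ide A X) (Zer A X X) (Ide A X)"
      and iso: "is_iso B (FA Q (Ide A X))"
      using i z i' Q'(5) by (simp_all add: roof_def)
    have "roof_arr B Q (Ide A X) f (Ide A X) = Zer B (FO Q X) (FO Q X)" if "f \<in> Hom A X X" for f
    proof -
      note v = Q.B.inv_arr(1)[OF Q.fa_in[OF i] iso]
      show ?thesis unfolding roof_arr_def
        using Q.B.is_zero_hom_to[OF QX Q.B.cmp_in[OF Q.B.cmp_in[OF v Q.fa_in[OF that]] v]] .
    qed
    then have "roof_eq A K X X (Ide A X) (Ide A X) (Ide A X) (Ide A X) (Zer A X X) (Ide A X)"
      using Q'(8)[OF roofs] i z by simp
    then obtain s f t a b a' b' where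
      a: "a \<in> Hom A (Dom A s) X" and b: "b \<in> Hom A X (Cod A t)" and
      a': "a' \<in> Hom A (Dom A s) X" and b': "b' \<in> Hom A X (Cod A t)" and
      r: "roof A K X X s f t" and
      e: "Ide A X \<cdot>\<^bsub>A\<^esub> a = s" "b \<cdot>\<^bsub>A\<^esub> Ide A X = t" "b \<cdot>\<^bsub>A\<^esub> (Ide A X \<cdot>\<^bsub>A\<^esub> a) = f" "b' \<cdot>\<^bsub>A\<^esub> (Zer A X X \<cdot>\<^bsub>A\<^esub> a') = f"
      unfolding roof_eq_def i' by blast
    \<comment> \<open>The legs being identities, the common refinement has \<open>a = s\<close> and
      \<open>b = t\<close>; comparing the two expressions for \<open>f\<close> shows that
      \<open>t\<close> kills \<open>s\<close>.\<close>
    have s: "s \<in> Hom A (Dom A s) X" and t: "t \<in> Hom A X (Cod A t)" and "t \<cdot>\<^bsub>A\<^esub> s = f"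
      using a b e Q.A.ide_cmp[OF a] Q.A.cmp_ide[OF b] by simp_all
    moreover have "f = Zer A (Dom A s) (Cod A t)"
      using e(4) Q.A.zer_cmp[OF a' X] Q.A.cmp_zer[OF b'] Q.A.Hom_objD[OF a'] by simp
    ultimately have ts: "t \<cdot>\<^bsub>A\<^esub> s = Zer A (Dom A s) (Cod A t)" by simp
    obtain c where sm: "monic A s" and c: "is_cokernel A s c" "Cod A c \<in> K"
      using r unfolding roof_def co_K_sub_def by blast
    obtain k where k: "is_kernel A t k" "Dom A k \<in> K"
      using r unfolding roof_def K_quot_def by blast
    note kk = Q.A.kernelD[OF k(1)]
    have k': "k \<in> Hom A (Dom A k) X" using kk(2) in_HomD[OF t] by simp
    \<comment> \<open>As \<open>t\<close> kills \<open>s\<close>, \<open>s\<close> factors through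
      the kernel \<open>k\<close> of \<open>t\<close>; the factor \<open>u\<close> will make
      \<open>Dom A s\<close> a subobject of an object of \<open>K\<close>.\<close>
    obtain u where u: "u \<in> Hom A (Dom A s) (Dom A k)" "k \<cdot>\<^bsub>A\<^esub> u = s"
      using kk(5)[of s "Dom A s"] s ts in_HomD[OF t] by auto
    note u' = in_HomD[OF u(1)]
    have "monic A u" unfolding monic_def
    proof (intro conjI allI ballI impI)
      show "u \<in> Arr A" by (rule u')
      fix W g h assume g: "g \<in> Hom A W (Dom A u)" and h: "h \<in> Hom A W (Dom A u)" and e: "u \<cdot>\<^bsub>A\<^esub> g = u \<cdot>\<^bsub>A\<^esub> h"
      then have g: "g \<in> Hom A W (Dom A s)" and h: "h \<in> Hom A W (Dom A s)" using u' by simp_all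
      have "s \<cdot>\<^bsub>A\<^esub> g = s \<cdot>\<^bsub>A\<^esub> h"
        using e Q.A.cmp_assoc[OF g u(1) k'] Q.A.cmp_assoc[OF h u(1) k'] u(2) by simp
      then show "g = h" using sm g h unfolding monic_def by blast
    qed
    moreover obtain d where d: "is_cokernel A u d" using Q.A.cokernel u' by blast
    ultimately have "short_exact A u d" using Q.A.kernel_of_cokernel by (simp add: short_exact_def)
    then have "Dom A s \<in> K" using K(3)[of u d] k(2) u' by simp
    \<comment> \<open>\<open>X\<close> is an extension of \<open>Cod A c\<close> by
      \<open>Dom A s\<close>, both in \<open>K\<close>.\<close>
    moreover have "short_exact A s c" using Q.A.kernel_of_cokernel[OF sm c(1)] c(1) by (simp add: short_exact_def)
    ultimately show "X \<in> K" using K(3)[of s c] c(2) in_HomD[OF s] by simp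
  qed
qed

text \<open>\<open>B\<close> has the objects of \<open>A\<close>, and by the computation of the
  kernel of \<open>Q\<close> its zero objects are exactly the members of \<open>K\<close>. The
  kernels of \<open>F\<close> and \<open>G\<close> coincide and contain these, so \<open>G\<close>
  kills nothing but zero objects exactly when that common kernel is \<open>K\<close>.\<close>

lemma serre_quotient_faithful_iff:
  assumes Q: "is_serre_quotient A K B Q" and G: "exact_tensor_functor B D G"
    and iso: "tensor_iso A D (cmp_tfctr D G Q) F"
  shows "faithful B G \<longleftrightarrow> Ker A D F = K"
proof -
  note Q' = serre_quotientD[OF Q]
  interpret G: exact_tensor_functor B D G by fact
  obtain \<theta> where "natural_iso A D (cmp_tfctr D G Q) F \<theta>" using iso unfolding tensor_iso_def by blast
  then have "Ker A D F = Ker A D (cmp_tfctr D G Q)"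
    using natural_iso_Ker G.B.linear_category_axioms by metis
  also have "\<dots> = Ker B D G" using Q'(3,4) by (auto simp: Ker_def cmp_tfctr_def)
  finally have F: "Ker A D F = Ker B D G" .
  have "Ker A B Q = {X \<in> Obj B. is_zero B X}" using Q'(3,4) by (auto simp: Ker_def)
  then have K: "K = {X \<in> Obj B. is_zero B X}" using serre_quotient_Ker[OF Q] by simp
  then have "K \<subseteq> Ker B D G" using G.fo_zero by (auto simp: Ker_def)
  moreover have "faithful B G \<longleftrightarrow> Ker B D G \<subseteq> K"
    unfolding G.faithful_iff K by (auto simp: Ker_def)
  ultimately show ?thesis using F by auto
qed

section \<open>Equivalences, and functors isomorphic to the identity\<close>

lemma equivalence_faithful:
  fixes F :: "('a, 'b, 'o, 'm, 'x) fctr_scheme"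
  assumes "equivalence A B F"
  shows "faithful A F"
  unfolding faithful_def
proof (intro allI inj_onI)
  fix X Y f g assume f: "f \<in> Hom A X Y" and g: "g \<in> Hom A X Y" and e: "FA F f = FA F g"
  interpret F: is_functor A B F using assms by (simp add: equivalence_def)
  obtain G :: "('o, 'm, 'a, 'b) fctr" and \<theta> where
    \<theta>: "natural_iso A A (cmp_fctr G F) id_fctr \<theta>" using assms unfolding equivalence_def by blast
  have X: "X \<in> Obj A" using F.A.Hom_objD[OF f] by blast
  have t: "\<theta> X \<in> Hom A (FO G (FO F X)) X" "is_iso A (\<theta> X)"
    using \<theta> X by (simp_all add: natural_iso_def cmp_fctr_def id_fctr_def)
  note v = F.A.inv_arr[OF t]
  \<comment> \<open>Naturality expresses each arrow composed with \<open>\<theta> X\<close> through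
    its image under \<open>F\<close>; inverting \<open>\<theta> X\<close> recovers the
    arrow.\<close>
  have "f \<cdot>\<^bsub>A\<^esub> \<theta> X = \<theta> Y \<cdot>\<^bsub>A\<^esub> FA G (FA F f)" "g \<cdot>\<^bsub>A\<^esub> \<theta> X = \<theta> Y \<cdot>\<^bsub>A\<^esub> FA G (FA F g)"
    using \<theta> f g by (simp_all add: natural_iso_def cmp_fctr_def id_fctr_def)
  then have "(f \<cdot>\<^bsub>A\<^esub> \<theta> X) \<cdot>\<^bsub>A\<^esub> inv_arr A (\<theta> X) = (g \<cdot>\<^bsub>A\<^esub> \<theta> X) \<cdot>\<^bsub>A\<^esub> inv_arr A (\<theta> X)" using e by simp
  then show "f = g"
    using F.A.cmp_assoc[OF v(1) t(1) f] F.A.cmp_assoc[OF v(1) t(1) g] v(3)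
      F.A.cmp_ide[OF f] F.A.cmp_ide[OF g] by simp
qed

lemma natural_iso_id_equivalence:
  assumes F: "is_functor B B F" and \<theta>: "natural_iso B B F id_fctr \<theta>"
  shows "equivalence B B F"
proof -
  interpret F: is_functor B B F by fact
  have "natural_iso B B (cmp_fctr id_fctr F) id_fctr \<theta>" "natural_iso B B (cmp_fctr F id_fctr) id_fctr \<theta>"
    using \<theta> by (simp_all add: natural_iso_def cmp_fctr_def id_fctr_def)
  then show ?thesis unfolding equivalence_def using F F.A.ide_functor by blast
qed

text \<open>The square at \<open>p\<close> is composed with the image of the inverse under
  \<open>G\<close> on one side and under \<open>F\<close> on the other. This serves the legs of a
  roof, which enter \<open>roof_arr\<close> inverted.\<close>

lemma natural_square_inverse:
  assumes "is_functor B D F" "is_functor B D G"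
    and p: "p \<in> Hom B X Y" "is_iso B p"
    and \<theta>: "\<theta> X \<in> Hom D (FO F X) (FO G X)" "\<theta> Y \<in> Hom D (FO F Y) (FO G Y)"
    and nat: "\<theta> Y \<cdot>\<^bsub>D\<^esub> FA F p = FA G p \<cdot>\<^bsub>D\<^esub> \<theta> X"
  shows "\<theta> X \<cdot>\<^bsub>D\<^esub> FA F (inv_arr B p) = FA G (inv_arr B p) \<cdot>\<^bsub>D\<^esub> \<theta> Y"
proof -
  interpret F: is_functor B D F by fact
  interpret G: is_functor B D G by fact
  let ?q = "inv_arr B p"
  note q = F.A.inv_arr[OF p] and o = F.A.Hom_objD[OF p(1)]
  note Fp = F.fa_in[OF p(1)] and Fq = F.fa_in[OF q(1)] and Gp = G.fa_in[OF p(1)] and Gq = G.fa_in[OF q(1)]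
  have "\<theta> X \<cdot>\<^bsub>D\<^esub> FA F ?q = FA G ?q \<cdot>\<^bsub>D\<^esub> (FA G p \<cdot>\<^bsub>D\<^esub> (\<theta> X \<cdot>\<^bsub>D\<^esub> FA F ?q))"
    using F.B.inv_cancel_left(1)[OF Gp G.fa_iso(1)[OF p] F.B.cmp_in[OF Fq \<theta>(1)]] G.fa_iso(2)[OF p] by simp
  also have "\<dots> = FA G ?q \<cdot>\<^bsub>D\<^esub> ((\<theta> Y \<cdot>\<^bsub>D\<^esub> FA F p) \<cdot>\<^bsub>D\<^esub> FA F ?q)"
    using F.B.cmp_assoc[OF Fq \<theta>(1) Gp] nat by simp
  also have "\<dots> = FA G ?q \<cdot>\<^bsub>D\<^esub> (\<theta> Y \<cdot>\<^bsub>D\<^esub> (FA F p \<cdot>\<^bsub>D\<^esub> FA F ?q))"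
    using F.B.cmp_assoc[OF Fq Fp \<theta>(2)] by simp
  also have "\<dots> = FA G ?q \<cdot>\<^bsub>D\<^esub> \<theta> Y"
    using F.fa_cmp[OF q(1) p(1)] q(3) F.fa_ide[OF o(2)] F.B.cmp_ide[OF \<theta>(2)] by simp
  finally show ?thesis .
qed

lemma natural_square_cmp:
  assumes "is_functor B D F" "is_functor B D G"
    and f: "f \<in> Hom B X Y" and g: "g \<in> Hom B Y Z"
    and \<theta>: "\<theta> X \<in> Hom D (FO F X) (FO G X)" "\<theta> Y \<in> Hom D (FO F Y) (FO G Y)" "\<theta> Z \<in> Hom D (FO F Z) (FO G Z)"
    and nat: "\<theta> Y \<cdot>\<^bsub>D\<^esub> FA F f = FA G f \<cdot>\<^bsub>D\<^esub> \<theta> X" "\<theta> Z \<cdot>\<^bsub>D\<^esub> FA F g = FA G g \<cdot>\<^bsub>D\<^esub> \<theta> Y"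
  shows "\<theta> Z \<cdot>\<^bsub>D\<^esub> FA F (g \<cdot>\<^bsub>B\<^esub> f) = FA G (g \<cdot>\<^bsub>B\<^esub> f) \<cdot>\<^bsub>D\<^esub> \<theta> X"
proof -
  interpret F: is_functor B D F by fact
  interpret G: is_functor B D G by fact
  note Ff = F.fa_in[OF f] and Fg = F.fa_in[OF g] and Gf = G.fa_in[OF f] and Gg = G.fa_in[OF g]
  have "\<theta> Z \<cdot>\<^bsub>D\<^esub> FA F (g \<cdot>\<^bsub>B\<^esub> f) = (FA G g \<cdot>\<^bsub>D\<^esub> \<theta> Y) \<cdot>\<^bsub>D\<^esub> FA F f"
    using F.fa_cmp[OF f g] F.B.cmp_assoc[OF Ff Fg \<theta>(3)] nat by simp
  also have "\<dots> = FA G (g \<cdot>\<^bsub>B\<^esub> f) \<cdot>\<^bsub>D\<^esub> \<theta> X"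
    using F.B.cmp_assoc[OF Ff \<theta>(2) Gg] nat F.B.cmp_assoc[OF \<theta>(1) Gf Gg] G.fa_cmp[OF f g] by simp
  finally show ?thesis .
qed

text \<open>Every arrow of the quotient is composed of arrows in the image of \<open>Q\<close> and of their inverses,
  so naturality on \<open>A\<close> implies naturality on \<open>A/K\<close>.\<close>

lemma serre_quotient_endofunctor_equivalence:
  fixes Q :: "('o, 'm, 'o, 'n) tfctr"
  assumes Q: "is_serre_quotient A K B Q" and G: "exact_tensor_functor B B G"
    and iso: "tensor_iso A B (cmp_tfctr B G Q) Q"
  shows "equivalence B B G"
proof -
  note Q' = serre_quotientD[OF Q]
  interpret Q: exact_tensor_functor A B Q by (rule Q'(2))
  interpret G: exact_tensor_functor B B G by fact
  let ?I = "id_fctr :: ('o, 'n, 'o, 'n) fctr"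
  have I: "is_functor B B ?I" by (rule Q.B.ide_functor)
  note GF = G.is_functor_axioms
  obtain \<theta> where \<theta>: "natural_iso A B (cmp_tfctr B G Q) Q \<theta>" using iso unfolding tensor_iso_def by blast
  \<comment> \<open>\<open>Q\<close> is the identity on objects, so the isomorphism of functors on
    \<open>A\<close> is at once a family indexed by the objects of the quotient, leading from
    \<open>G\<close> to the identity.\<close>
  have t: "\<theta> X \<in> Hom B (FO G X) (FO ?I X) \<and> is_iso B (\<theta> X)" if "X \<in> Obj A" for X
  proof -
    have "\<theta> X \<in> Hom B (FO G (FO Q X)) (FO Q X) \<and> is_iso B (\<theta> X)"
      using \<theta> that by (simp add: natural_iso_def cmp_tfctr_def)
    then show ?thesis using Q'(4)[OF that] by (simp add: id_fctr_def)
  qed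
  have nat: "\<theta> Y \<cdot>\<^bsub>B\<^esub> FA G (FA Q f) = FA ?I (FA Q f) \<cdot>\<^bsub>B\<^esub> \<theta> X" if "f \<in> Hom A X Y" for f X Y
    using \<theta> that by (simp add: natural_iso_def cmp_tfctr_def id_fctr_def)
  have "\<theta> Y \<cdot>\<^bsub>B\<^esub> FA G g = FA ?I g \<cdot>\<^bsub>B\<^esub> \<theta> X" if g: "g \<in> Hom B X Y" for g X Y
  proof -
    have XY: "X \<in> Obj A" "Y \<in> Obj A" using Q.B.Hom_objD[OF g] Q'(3) by simp_all
    obtain s f u where r: "roof A K X Y s f u" and gr: "g = roof_arr B Q s f u"
      using Q'(7)[OF XY g] by blast
    let ?X = "Dom A s" and ?Y = "Cod A u"
    have sK: "co_K_sub A K s" and uK: "K_quot A K u" using r by (simp_all add: roof_def)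
    have s: "s \<in> Hom A ?X X" and f: "f \<in> Hom A ?X ?Y" and u: "u \<in> Hom A Y ?Y"
      using r by (auto simp: roof_def co_K_sub_def K_quot_def monic_def epic_def Hom_def)
    have o: "?X \<in> Obj A" "?Y \<in> Obj A" using Q.A.Hom_objD[OF f] by auto
    have Qs: "FA Q s \<in> Hom B ?X X" and Qf: "FA Q f \<in> Hom B ?X ?Y" and Qu: "FA Q u \<in> Hom B Y ?Y"
      using Q.fa_in[OF s] Q.fa_in[OF f] Q.fa_in[OF u] Q'(4) XY o by simp_all
    note si = Q'(5)[OF sK] and ui = Q'(6)[OF uK]
    note s' = Q.B.inv_arr(1)[OF Qs si] and u' = Q.B.inv_arr(1)[OF Qu ui]
    note tX = t[OF XY(1), THEN conjunct1] and tY = t[OF XY(2), THEN conjunct1]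
      and tX' = t[OF o(1), THEN conjunct1] and tY' = t[OF o(2), THEN conjunct1]
    note ns = natural_square_inverse[where \<theta> = \<theta>, OF GF I Qs si tX' tX nat[OF s]]
      and nu = natural_square_inverse[where \<theta> = \<theta>, OF GF I Qu ui tY tY' nat[OF u]]
    note 1 = natural_square_cmp[where \<theta> = \<theta>, OF GF I s' Qf tX tX' tY' ns nat[OF f]]
    show ?thesis
      using natural_square_cmp[where \<theta> = \<theta>, OF GF I Q.B.cmp_in[OF s' Qf] u' tX tY' tY 1 nu]
      unfolding gr roof_arr_def .
  qed
  then have "natural_iso B B G id_fctr \<theta>" using t Q'(3) by (simp add: natural_iso_def)
  then show ?thesis using natural_iso_id_equivalence[OF GF] by blast
qed

section \<open>The identity as an exact tensor functor\<close>

definition id_tfctr :: "('o, 'm, 'z) tcat_scheme \<Rightarrow> ('o, 'm, 'o, 'm) tfctr" where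
  "id_tfctr B = \<lparr>FO = (\<lambda>X. X), FA = (\<lambda>f. f), FMu = (\<lambda>X Y. Ide B (X \<odot>\<^bsub>B\<^esub> Y)), FEps = Ide B (Unit B)\<rparr>"

lemma id_tfctr_simps [simp]:
  "FO (id_tfctr B) X = X" "FA (id_tfctr B) f = f"
  "FMu (id_tfctr B) X Y = Ide B (X \<odot>\<^bsub>B\<^esub> Y)" "FEps (id_tfctr B) = Ide B (Unit B)"
  by (simp_all add: id_tfctr_def)

lemma (in ex_tensor_category) id_exact_tensor_functor: "exact_tensor_functor C C (id_tfctr C)"
proof unfold_locales
  fix X Y assume X: "X \<in> Obj C" and Y: "Y \<in> Obj C"
  have XY: "X \<odot> Y \<in> Obj C" using tenO_in[OF X Y] .
  show "FMu (id_tfctr C) X Y \<in> Hom C (FO (id_tfctr C) X \<odot> FO (id_tfctr C) Y) (FO (id_tfctr C) (X \<odot> Y)) \<and>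
      is_iso C (FMu (id_tfctr C) X Y)"
    using ide_in[OF XY] ide_iso[OF XY] by simp
  show "FA (id_tfctr C) (Brd C X Y) \<cdot> FMu (id_tfctr C) X Y =
      FMu (id_tfctr C) Y X \<cdot> Brd C (FO (id_tfctr C) X) (FO (id_tfctr C) Y)"
    using cmp_ide[OF brd_in[OF X Y]] ide_cmp[OF brd_in[OF X Y]] by simp
  fix Z assume Z: "Z \<in> Obj C"
  have YZ: "Y \<odot> Z \<in> Obj C" and o: "(X \<odot> Y) \<odot> Z \<in> Obj C" "X \<odot> (Y \<odot> Z) \<in> Obj C"
    using tenO_in X Y Z by simp_all
  note a = conjunct1[OF asc_in[OF X Y Z]]
  show "FA (id_tfctr C) (Asc C X Y Z) \<cdot> (FMu (id_tfctr C) (X \<odot> Y) Z \<cdot> (FMu (id_tfctr C) X Y \<otimes> Ide C (FO (id_tfctr C) Z))) =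
      FMu (id_tfctr C) X (Y \<odot> Z) \<cdot> ((Ide C (FO (id_tfctr C) X) \<otimes> FMu (id_tfctr C) Y Z) \<cdot>
        Asc C (FO (id_tfctr C) X) (FO (id_tfctr C) Y) (FO (id_tfctr C) Z))"
    using ten_ide[OF XY Z] ten_ide[OF X YZ] ide_cmp[OF ide_in[OF o(1)]] cmp_ide[OF a] ide_cmp[OF a] by simp
next
  fix X assume X: "X \<in> Obj C"
  note l = conjunct1[OF lun_in[OF X]] and r = conjunct1[OF run_in[OF X]]
  have o: "Unit C \<odot> X \<in> Obj C" "X \<odot> Unit C \<in> Obj C" using tenO_in X unit_in by simp_all
  show "FA (id_tfctr C) (LUn C X) \<cdot> (FMu (id_tfctr C) (Unit C) X \<cdot> (FEps (id_tfctr C) \<otimes> Ide C (FO (id_tfctr C) X))) =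
      LUn C (FO (id_tfctr C) X)"
    using ten_ide[OF unit_in X] ide_cmp[OF ide_in[OF o(1)]] cmp_ide[OF l] by simp
  show "FA (id_tfctr C) (RUn C X) \<cdot> (FMu (id_tfctr C) X (Unit C) \<cdot> (Ide C (FO (id_tfctr C) X) \<otimes> FEps (id_tfctr C))) =
      RUn C (FO (id_tfctr C) X)"
    using ten_ide[OF X unit_in] ide_cmp[OF ide_in[OF o(2)]] cmp_ide[OF r] by simp
next
  show "FEps (id_tfctr C) \<in> Hom C (Unit C) (FO (id_tfctr C) (Unit C)) \<and> is_iso C (FEps (id_tfctr C))"
    using ide_in[OF unit_in] ide_iso[OF unit_in] by simp
next
  fix f X X' g Y Y' assume f: "f \<in> Hom C X X'" and g: "g \<in> Hom C Y Y'"
  show "FMu (id_tfctr C) X' Y' \<cdot> (FA (id_tfctr C) f \<otimes> FA (id_tfctr C) g) = FA (id_tfctr C) (f \<otimes> g) \<cdot> FMu (id_tfctr C) X Y"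
    using ide_cmp[OF tenA_in[OF f g]] cmp_ide[OF tenA_in[OF f g]] by simp
qed simp_all

text \<open>Equal kernels select the same values of \<open>quo\<close> and \<open>prj\<close>; the
  equivalence under \<open>A\<close> between the two quotients is then the identity with trivial
  coherence data.\<close>

lemma equivalent_under_refl:
  assumes P: "exact_tensor_functor A B P"
  shows "equivalent_under A B P B P"
proof -
  interpret P: exact_tensor_functor A B P by fact
  let ?\<theta> = "\<lambda>X. Ide B (FO P X)"
  have E: "exact_tensor_functor B B (id_tfctr B)" by (rule P.B.id_exact_tensor_functor)
  then interpret E: exact_tensor_functor B B "id_tfctr B" .
  have "natural_iso B B (id_tfctr B) id_fctr (Ide B)"
    using P.B.ide_in P.B.ide_iso P.B.ide_cmp P.B.cmp_ide by (simp add: natural_iso_def id_fctr_def)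
  then have "equivalence B B (id_tfctr B)" using natural_iso_id_equivalence[OF E.is_functor_axioms] by blast
  moreover have "tensor_iso A B (cmp_tfctr B (id_tfctr B) P) P"
    unfolding tensor_iso_def
  proof (intro exI conjI ballI)
    show "natural_iso A B (cmp_tfctr B (id_tfctr B) P) P ?\<theta>"
      unfolding natural_iso_def cmp_tfctr_def
      using P.B.ide_in P.B.ide_iso P.B.ide_cmp[OF P.fa_in] P.B.cmp_ide[OF P.fa_in] P.fo_in by simp
    show "?\<theta> (Unit A) \<cdot>\<^bsub>B\<^esub> FEps (cmp_tfctr B (id_tfctr B) P) = FEps P"
      using P.B.ide_cmp[OF conjunct1[OF P.eps_in]] P.B.cmp_ide[OF conjunct1[OF P.eps_in]] by (simp add: cmp_tfctr_def)
    fix X Y assume X: "X \<in> Obj A" and Y: "Y \<in> Obj A"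
    note m = conjunct1[OF P.mu_in[OF X Y]] and o = P.fo_in[OF X] P.fo_in[OF Y]
    show "?\<theta> (X \<odot>\<^bsub>A\<^esub> Y) \<cdot>\<^bsub>B\<^esub> FMu (cmp_tfctr B (id_tfctr B) P) X Y = FMu P X Y \<cdot>\<^bsub>B\<^esub> (?\<theta> X \<otimes>\<^bsub>B\<^esub> ?\<theta> Y)"
      using P.B.ten_ide[OF o] P.B.ide_cmp[OF m] P.B.cmp_ide[OF m] by (simp add: cmp_tfctr_def)
  qed
  ultimately show ?thesis unfolding equivalent_under_def using E by blast
qed

text \<open>The equivalence is faithful, and composed with \<open>Q\<close> it is isomorphic to
  \<open>Q'\<close>, so the kernel of \<open>Q'\<close> is \<open>K\<close>. Being a projection
  itself, \<open>Q'\<close> has kernel \<open>K'\<close>.\<close>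

lemma equivalent_under_Ker:
  assumes Q: "is_serre_quotient A K B Q" and Q': "is_serre_quotient A K' B' Q'"
    and "equivalent_under A B Q B' Q'"
  shows "K = K'"
  using assms(3) serre_quotient_faithful_iff[OF Q] equivalence_faithful serre_quotient_Ker[OF Q']
  unfolding equivalent_under_def by metis

text \<open>The absolute and the relative case share this statement, in which a cohomology is
  reduced to a label of arbitrary type \<open>'h\<close> for the functor \<open>F h\<close>.\<close>

lemma serre_quotient_criterion:
  fixes A :: "('o, 'm) lcat" and S :: "(('p, 'q) lcat \<times> 'h) set"
    and quo :: "'o set \<Rightarrow> ('o, 'n) lcat"
  assumes quo: "\<And>K. serre_tensor_ideal A K \<Longrightarrow> is_serre_quotient A K (quo K) (prj K)"
    and F: "\<And>h. h \<in> S \<Longrightarrow> exact_tensor_functor A (fst h) (F h)"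
    and r: "\<And>h. h \<in> S \<Longrightarrow> induced_by A (quo (joint_Ker A S F)) (fst h) (prj (joint_Ker A S F)) (F h) (r h)"
    and can: "\<And>h. h \<in> S \<Longrightarrow> induced_by A (quo (joint_Ker A S F)) (quo (Ker A (fst h) (F h)))
                   (prj (joint_Ker A S F)) (prj (Ker A (fst h) (F h))) (can h)"
  shows "(\<forall>h \<in> S. \<forall>k \<in> S. equivalent_under A
             (quo (Ker A (fst h) (F h))) (prj (Ker A (fst h) (F h)))
             (quo (Ker A (fst k) (F k))) (prj (Ker A (fst k) (F k)))) \<longleftrightarrow>
         (\<forall>h \<in> S. faithful (quo (joint_Ker A S F)) (r h))" (is "?eq \<longleftrightarrow> ?faith")
    and "(\<forall>h \<in> S. faithful (quo (joint_Ker A S F)) (r h)) \<longleftrightarrow>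
         (\<forall>h \<in> S. equivalence (quo (joint_Ker A S F)) (quo (Ker A (fst h) (F h))) (can h))"
      (is "_ \<longleftrightarrow> ?can")
proof -
  let ?K = "joint_Ker A S F" and ?Kh = "\<lambda>h. Ker A (fst h) (F h)"
  have Qh: "is_serre_quotient A (?Kh h) (quo (?Kh h)) (prj (?Kh h))" if "h \<in> S" for h
    using quo exact_tensor_functor.Ker_serre_tensor_ideal[OF F[OF that]] by blast
  \<comment> \<open>The element \<open>h\<close> witnesses that \<open>S\<close> is non-empty, as
    the lemma on the joint kernel requires.\<close>
  have Q: "is_serre_quotient A ?K (quo ?K) (prj ?K)" if "h \<in> S" for h
    using quo joint_Ker_serre_tensor_ideal[OF _ F] that by blast
  have "faithful (quo ?K) (r h) \<longleftrightarrow> ?Kh h = ?K" if h: "h \<in> S" for h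
    using serre_quotient_faithful_iff[OF Q[OF h]] r[OF h] unfolding induced_by_def by blast
  then have faith: "?faith \<longleftrightarrow> (\<forall>h \<in> S. ?Kh h = ?K)" by blast
  have "equivalence (quo ?K) (quo (?Kh h)) (can h) \<longleftrightarrow> ?Kh h = ?K" if h: "h \<in> S" for h
  proof
    assume "equivalence (quo ?K) (quo (?Kh h)) (can h)"
    then have "faithful (quo ?K) (can h)" by (rule equivalence_faithful)
    \<comment> \<open>The projection to the quotient by \<open>?Kh h\<close> takes the place of
      \<open>F\<close> in the faithfulness criterion, since it is what \<open>can h\<close> is
      induced by.\<close>
    then have "Ker A (quo (?Kh h)) (prj (?Kh h)) = ?K"
      using serre_quotient_faithful_iff[OF Q[OF h]] can[OF h] unfolding induced_by_def by blast
    then show "?Kh h = ?K" using serre_quotient_Ker[OF Qh[OF h]] by simp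
  next
    assume "?Kh h = ?K"
    \<comment> \<open>Equal ideals give the same quotient and projection, so \<open>can h\<close> is
      an endofunctor that fixes the projection up to isomorphism.\<close>
    then show "equivalence (quo ?K) (quo (?Kh h)) (can h)"
      using serre_quotient_endofunctor_equivalence[OF Q[OF h]] can[OF h] unfolding induced_by_def by simp
  qed
  then show "?faith \<longleftrightarrow> ?can" using faith by blast
  have "equivalent_under A (quo (?Kh h)) (prj (?Kh h)) (quo (?Kh k)) (prj (?Kh k)) \<longleftrightarrow> ?Kh h = ?Kh k"
    if "h \<in> S" "k \<in> S" for h k
    using equivalent_under_Ker[OF Qh Qh] equivalent_under_refl serre_quotientD(2)[OF Qh] that by metis
  then have "?eq \<longleftrightarrow> (\<forall>h \<in> S. \<forall>k \<in> S. ?Kh h = ?Kh k)" by blast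
  \<comment> \<open>Kernels that equal one another equal their intersection; for empty
    \<open>S\<close> both sides are vacuous.\<close>
  also have "\<dots> \<longleftrightarrow> (\<forall>h \<in> S. ?Kh h = ?K)"
    by (cases "S = {}") (simp, auto simp: joint_Ker_eq)
  finally show "?eq \<longleftrightarrow> ?faith" using faith by blast
qed

section \<open>Push-forward of cohomologies\<close>

lemma push_simps [simp]:
  "HO (push A B F H) i X = FO F (HO H i X)" "HA (push A B F H) i f = FA F (HA H i f)"
  "Kap (push A B F H) i j X Y = FA F (Kap H i j X Y) \<cdot>\<^bsub>B\<^esub> FMu F (HO H i X) (HO H j Y)"
  "Ups (push A B F H) = inv_arr B (FEps F) \<cdot>\<^bsub>B\<^esub> FA F (Ups H)"
  by (simp_all add: push_def)

lemma rel_push_simps [simp]: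
  "HO (rel_push A B F H) = HO (push A B F H)" "HA (rel_push A B F H) = HA (push A B F H)"
  "Kap (rel_push A B F H) = Kap (push A B F H)" "Ups (rel_push A B F H) = Ups (push A B F H)"
  "Bd (rel_push A B F H) n i j = FA F (Bd H n i j)"
  by (simp_all add: rel_push_def coh.defs rel_coh.defs push_def)

text \<open>The isomorphism is \<open>\<theta>\<close> evaluated on the values of \<open>U\<close>,
  followed by \<open>\<phi>\<close>, and each condition is a pasting of squares. External products
  combine naturality of \<open>\<theta>\<close> at \<open>Kap\<close> with its compatibility with
  the tensor constraints; \<open>Ups\<close> uses its compatibility with the unit
  constraints.\<close>

lemma coh_iso_via_push_cmp:
  assumes U: "kunneth_cohomology T A U" and H: "kunneth_cohomology T D H"
    and P: "exact_tensor_functor A B P" and R: "exact_tensor_functor B D R"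
    and F: "exact_tensor_functor A D F"
    and nat: "natural_iso A D (cmp_tfctr D R P) F \<theta>"
    and mu: "\<And>X Y. X \<in> Obj A \<Longrightarrow> Y \<in> Obj A \<Longrightarrow>
        \<theta> (X \<odot>\<^bsub>A\<^esub> Y) \<cdot>\<^bsub>D\<^esub> FMu (cmp_tfctr D R P) X Y = FMu F X Y \<cdot>\<^bsub>D\<^esub> (\<theta> X \<otimes>\<^bsub>D\<^esub> \<theta> Y)"
    and eps: "\<theta> (Unit A) \<cdot>\<^bsub>D\<^esub> FEps (cmp_tfctr D R P) = FEps F"
    and \<phi>: "coh_iso_via T D (push A D F U) H \<phi>"
  shows "coh_iso_via T D (push B D R (push A B P U)) H (\<lambda>i X. \<phi> i X \<cdot>\<^bsub>D\<^esub> \<theta> (HO U i X))"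
proof -
  interpret U: kunneth_cohomology T A U by fact
  interpret H: kunneth_cohomology T D H by fact
  interpret P: exact_tensor_functor A B P by fact
  interpret R: exact_tensor_functor B D R by fact
  interpret F: exact_tensor_functor A D F by fact
  let ?G = "\<lambda>X. FO R (FO P X)" and ?g = "\<lambda>f. FA R (FA P f)"
  have t: "\<theta> X \<in> Hom D (?G X) (FO F X)" "is_iso D (\<theta> X)" if "X \<in> Obj A" for X
    using nat that by (simp_all add: natural_iso_def cmp_tfctr_def)
  have tn: "\<theta> Y \<cdot>\<^bsub>D\<^esub> ?g f = FA F f \<cdot>\<^bsub>D\<^esub> \<theta> X" if "f \<in> Hom A X Y" for f X Y
    using nat that by (simp add: natural_iso_def cmp_tfctr_def)
  have p: "\<phi> i X \<in> Hom D (FO F (HO U i X)) (HO H i X)" "is_iso D (\<phi> i X)" if "X \<in> Obj T" for i X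
    using \<phi> that by (simp_all add: coh_iso_via_def)
  have pn: "\<phi> i X \<cdot>\<^bsub>D\<^esub> FA F (HA U i f) = HA H i f \<cdot>\<^bsub>D\<^esub> \<phi> i Y" if "f \<in> Hom T X Y" for i f X Y
    using \<phi> that by (simp add: coh_iso_via_def)
  have pk: "\<phi> (i + j) (X \<odot>\<^bsub>T\<^esub> Y) \<cdot>\<^bsub>D\<^esub> (FA F (Kap U i j X Y) \<cdot>\<^bsub>D\<^esub> FMu F (HO U i X) (HO U j Y)) =
      Kap H i j X Y \<cdot>\<^bsub>D\<^esub> (\<phi> i X \<otimes>\<^bsub>D\<^esub> \<phi> j Y)" if "X \<in> Obj T" "Y \<in> Obj T" for i j X Y
    using \<phi> that by (simp add: coh_iso_via_def)
  have pu: "Ups H \<cdot>\<^bsub>D\<^esub> \<phi> 0 (Unit T) = inv_arr D (FEps F) \<cdot>\<^bsub>D\<^esub> FA F (Ups U)"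
    using \<phi> by (simp add: coh_iso_via_def)
  note ho = U.ho_in
  have g: "?g f \<in> Hom D (?G X) (?G Y)" if "f \<in> Hom A X Y" for f X Y
    using R.fa_in[OF P.fa_in[OF that]] .
  have "\<phi> i X \<cdot>\<^bsub>D\<^esub> \<theta> (HO U i X) \<in> Hom D (?G (HO U i X)) (HO H i X)"
    "is_iso D (\<phi> i X \<cdot>\<^bsub>D\<^esub> \<theta> (HO U i X))" if X: "X \<in> Obj T" for i X
    using H.A.cmp_in[OF t(1) p(1)[OF X]] H.A.cmp_inverse(1)[OF t p[OF X]] ho[OF X] by simp_all
  moreover have "(\<phi> i X \<cdot>\<^bsub>D\<^esub> \<theta> (HO U i X)) \<cdot>\<^bsub>D\<^esub> ?g (HA U i f) = HA H i f \<cdot>\<^bsub>D\<^esub> (\<phi> i Y \<cdot>\<^bsub>D\<^esub> \<theta> (HO U i Y))"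
    if f: "f \<in> Hom T X Y" for i f X Y
  proof -
    have X: "X \<in> Obj T" and Y: "Y \<in> Obj T" using U.T.Hom_objD[OF f] by auto
    note u = U.ha_in[OF f, of i]
    have "(\<phi> i X \<cdot>\<^bsub>D\<^esub> \<theta> (HO U i X)) \<cdot>\<^bsub>D\<^esub> ?g (HA U i f) = \<phi> i X \<cdot>\<^bsub>D\<^esub> (FA F (HA U i f) \<cdot>\<^bsub>D\<^esub> \<theta> (HO U i Y))"
      using H.A.cmp_assoc[OF g[OF u] t(1)[OF ho[OF X]] p(1)[OF X]] tn[OF u] by simp
    also have "\<dots> = (HA H i f \<cdot>\<^bsub>D\<^esub> \<phi> i Y) \<cdot>\<^bsub>D\<^esub> \<theta> (HO U i Y)"
      using H.A.cmp_assoc[OF t(1)[OF ho[OF Y]] F.fa_in[OF u] p(1)[OF X]] pn[OF f] by simp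
    also have "\<dots> = HA H i f \<cdot>\<^bsub>D\<^esub> (\<phi> i Y \<cdot>\<^bsub>D\<^esub> \<theta> (HO U i Y))"
      using H.A.cmp_assoc[OF t(1)[OF ho[OF Y]] p(1)[OF Y] H.ha_in[OF f]] .
    finally show ?thesis .
  qed
  moreover have "(\<phi> (i + j) (X \<odot>\<^bsub>T\<^esub> Y) \<cdot>\<^bsub>D\<^esub> \<theta> (HO U (i + j) (X \<odot>\<^bsub>T\<^esub> Y))) \<cdot>\<^bsub>D\<^esub>
      (FA R (FA P (Kap U i j X Y) \<cdot>\<^bsub>B\<^esub> FMu P (HO U i X) (HO U j Y)) \<cdot>\<^bsub>D\<^esub> FMu R (FO P (HO U i X)) (FO P (HO U j Y))) =
      Kap H i j X Y \<cdot>\<^bsub>D\<^esub> ((\<phi> i X \<cdot>\<^bsub>D\<^esub> \<theta> (HO U i X)) \<otimes>\<^bsub>D\<^esub> (\<phi> j Y \<cdot>\<^bsub>D\<^esub> \<theta> (HO U j Y)))"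
    if X: "X \<in> Obj T" and Y: "Y \<in> Obj T" for i j X Y
  proof -
    let ?x = "HO U i X" and ?y = "HO U j Y" and ?z = "HO U (i + j) (X \<odot>\<^bsub>T\<^esub> Y)"
    let ?k = "Kap U i j X Y" and ?\<phi> = "\<phi> (i + j) (X \<odot>\<^bsub>T\<^esub> Y)"
    let ?m = "FMu (cmp_tfctr D R P) ?x ?y"
    have XY: "X \<odot>\<^bsub>T\<^esub> Y \<in> Obj T" using U.T.tenO_in[OF X Y] .
    note x = ho[OF X, of i] and y = ho[OF Y, of j] and z = ho[OF XY, of "i + j"]
    have xy: "?x \<odot>\<^bsub>A\<^esub> ?y \<in> Obj A" using U.A.tenO_in[OF x y] .
    note k = U.kap_in[OF X Y, of i j]
    note mP = conjunct1[OF P.mu_in[OF x y]]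
    note mR = conjunct1[OF R.mu_in[OF P.fo_in[OF x] P.fo_in[OF y]]]
    note mF = conjunct1[OF F.mu_in[OF x y]]
    have m: "?m \<in> Hom D (?G ?x \<odot>\<^bsub>D\<^esub> ?G ?y) (?G (?x \<odot>\<^bsub>A\<^esub> ?y))"
      using H.A.cmp_in[OF mR R.fa_in[OF mP]] by (simp add: cmp_tfctr_def)
    note Fk = F.fa_in[OF k] and tt = H.A.tenA_in[OF t(1)[OF x] t(1)[OF y]]
      and pp = H.A.tenA_in[OF p(1)[OF X, of i] p(1)[OF Y, of j]]
    \<comment> \<open>Pushing forward twice yields the external product of the push-forward along
      the composite functor, whose tensor constraint is \<open>?m\<close>.\<close>
    have "FA R (FA P ?k \<cdot>\<^bsub>B\<^esub> FMu P ?x ?y) \<cdot>\<^bsub>D\<^esub> FMu R (FO P ?x) (FO P ?y) = ?g ?k \<cdot>\<^bsub>D\<^esub> ?m"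
      using R.fa_cmp[OF mP P.fa_in[OF k]] H.A.cmp_assoc[OF mR R.fa_in[OF mP] g[OF k]]
      by (simp add: cmp_tfctr_def)
    moreover have "(?\<phi> \<cdot>\<^bsub>D\<^esub> \<theta> ?z) \<cdot>\<^bsub>D\<^esub> (?g ?k \<cdot>\<^bsub>D\<^esub> ?m) = ?\<phi> \<cdot>\<^bsub>D\<^esub> ((\<theta> ?z \<cdot>\<^bsub>D\<^esub> ?g ?k) \<cdot>\<^bsub>D\<^esub> ?m)"
      using H.A.cmp_assoc[OF H.A.cmp_in[OF m g[OF k]] t(1)[OF z] p(1)[OF XY]]
        H.A.cmp_assoc[OF m g[OF k] t(1)[OF z]] by simp
    moreover have "(\<theta> ?z \<cdot>\<^bsub>D\<^esub> ?g ?k) \<cdot>\<^bsub>D\<^esub> ?m = FA F ?k \<cdot>\<^bsub>D\<^esub> (FMu F ?x ?y \<cdot>\<^bsub>D\<^esub> (\<theta> ?x \<otimes>\<^bsub>D\<^esub> \<theta> ?y))"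
      using tn[OF k] H.A.cmp_assoc[OF m t(1)[OF xy] Fk] mu[OF x y] by simp
    moreover have "?\<phi> \<cdot>\<^bsub>D\<^esub> (FA F ?k \<cdot>\<^bsub>D\<^esub> (FMu F ?x ?y \<cdot>\<^bsub>D\<^esub> (\<theta> ?x \<otimes>\<^bsub>D\<^esub> \<theta> ?y))) =
        (?\<phi> \<cdot>\<^bsub>D\<^esub> (FA F ?k \<cdot>\<^bsub>D\<^esub> FMu F ?x ?y)) \<cdot>\<^bsub>D\<^esub> (\<theta> ?x \<otimes>\<^bsub>D\<^esub> \<theta> ?y)"
      using H.A.cmp_assoc[OF tt mF Fk] H.A.cmp_assoc[OF tt H.A.cmp_in[OF mF Fk] p(1)[OF XY]] by simp
    moreover have "\<dots> = Kap H i j X Y \<cdot>\<^bsub>D\<^esub> ((\<phi> i X \<cdot>\<^bsub>D\<^esub> \<theta> ?x) \<otimes>\<^bsub>D\<^esub> (\<phi> j Y \<cdot>\<^bsub>D\<^esub> \<theta> ?y))"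
      using pk[OF X Y] H.A.cmp_assoc[OF tt pp H.kap_in[OF X Y]]
        H.A.ten_cmp[OF t(1)[OF x] p(1)[OF X] t(1)[OF y] p(1)[OF Y]] by simp
    ultimately show ?thesis by simp
  qed
  moreover have "Ups H \<cdot>\<^bsub>D\<^esub> (\<phi> 0 (Unit T) \<cdot>\<^bsub>D\<^esub> \<theta> (HO U 0 (Unit T))) =
      inv_arr D (FEps R) \<cdot>\<^bsub>D\<^esub> FA R (inv_arr B (FEps P) \<cdot>\<^bsub>B\<^esub> FA P (Ups U))"
  proof -
    let ?u = "Unit A" and ?h = "HO U 0 (Unit T)" and ?e = "FEps (cmp_tfctr D R P)"
    note h = ho[OF U.T.unit_in, of 0] and u = U.A.unit_in
    note eP = P.eps_in[THEN conjunct1] P.eps_in[THEN conjunct2]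
      and eR = R.eps_in[THEN conjunct1] R.eps_in[THEN conjunct2]
      and eF = F.eps_in[THEN conjunct1] F.eps_in[THEN conjunct2]
      and v = U.ups_iso[THEN conjunct1] and w = H.ups_iso[THEN conjunct1]
    note iP = P.B.inv_arr(1)[OF eP] and iR = H.A.inv_arr(1)[OF eR] and iF = H.A.inv_arr(1)[OF eF]
    note e = R.fa_in[OF eP(1)] R.fa_iso(1)[OF eP]
    have G: "?e = FA R (FEps P) \<cdot>\<^bsub>D\<^esub> FEps R" by (simp add: cmp_tfctr_def)
    note eG = H.A.cmp_in[OF eR(1) e(1), folded G] H.A.cmp_inverse(1)[OF eR e, folded G]
    note iG = H.A.inv_arr(1)[OF eG]
    have iG': "inv_arr D ?e = inv_arr D (FEps R) \<cdot>\<^bsub>D\<^esub> FA R (inv_arr B (FEps P))"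
      using H.A.cmp_inverse(2)[OF eR e] R.fa_iso(2)[OF eP] G by simp
    \<comment> \<open>\<open>eps\<close> says that \<open>\<theta> ?u\<close> carries the unit
      constraint of the composite to that of \<open>F\<close>. It is inverted here because
      \<open>Ups\<close> of a push-forward contains the inverse of the unit constraint.\<close>
    have "inv_arr D (FEps F) = inv_arr D ?e \<cdot>\<^bsub>D\<^esub> inv_arr D (\<theta> ?u)"
      using H.A.cmp_inverse(2)[OF eG t[OF u]] eps by simp
    then have i: "inv_arr D (FEps F) \<cdot>\<^bsub>D\<^esub> \<theta> ?u = inv_arr D ?e"
      using H.A.cmp_assoc[OF t(1)[OF u] H.A.inv_arr(1)[OF t[OF u]] iG]
        H.A.inv_arr(2)[OF t[OF u]] H.A.cmp_ide[OF iG] by simp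
    have "Ups H \<cdot>\<^bsub>D\<^esub> (\<phi> 0 (Unit T) \<cdot>\<^bsub>D\<^esub> \<theta> ?h) = (inv_arr D (FEps F) \<cdot>\<^bsub>D\<^esub> FA F (Ups U)) \<cdot>\<^bsub>D\<^esub> \<theta> ?h"
      using H.A.cmp_assoc[OF t(1)[OF h] p(1)[OF U.T.unit_in] w] pu by simp
    also have "\<dots> = inv_arr D (FEps F) \<cdot>\<^bsub>D\<^esub> (\<theta> ?u \<cdot>\<^bsub>D\<^esub> ?g (Ups U))"
      using H.A.cmp_assoc[OF t(1)[OF h] F.fa_in[OF v] iF] tn[OF v] by simp
    also have "\<dots> = inv_arr D ?e \<cdot>\<^bsub>D\<^esub> ?g (Ups U)"
      using H.A.cmp_assoc[OF g[OF v] t(1)[OF u] iF] i by simp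
    also have "\<dots> = inv_arr D (FEps R) \<cdot>\<^bsub>D\<^esub> (FA R (inv_arr B (FEps P)) \<cdot>\<^bsub>D\<^esub> ?g (Ups U))"
      using H.A.cmp_assoc[OF g[OF v] R.fa_in[OF iP] iR] iG' by simp
    finally show ?thesis using R.fa_cmp[OF P.fa_in[OF v] iP] by simp
  qed
  ultimately show ?thesis unfolding coh_iso_via_def by (simp add: U.T.unit_in)
qed

lemma classifies_induced:
  assumes "kunneth_cohomology T A U" "kunneth_cohomology T D H"
    and P: "exact_tensor_functor A B P" and F: "classifies T A U D H F" and R: "induced_by A B D P F R"
  shows "classifies T B (push A B P U) D H R"
proof -
  obtain \<theta> where "natural_iso A D (cmp_tfctr D R P) F \<theta>"
    "\<And>X Y. X \<in> Obj A \<Longrightarrow> Y \<in> Obj A \<Longrightarrow>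
        \<theta> (X \<odot>\<^bsub>A\<^esub> Y) \<cdot>\<^bsub>D\<^esub> FMu (cmp_tfctr D R P) X Y = FMu F X Y \<cdot>\<^bsub>D\<^esub> (\<theta> X \<otimes>\<^bsub>D\<^esub> \<theta> Y)"
    "\<theta> (Unit A) \<cdot>\<^bsub>D\<^esub> FEps (cmp_tfctr D R P) = FEps F"
    using R unfolding induced_by_def tensor_iso_def by blast
  moreover obtain \<phi> where "coh_iso_via T D (push A D F U) H \<phi>"
    using F unfolding classifies_def coh_iso_def by blast
  ultimately have "coh_iso_via T D (push B D R (push A B P U)) H (\<lambda>i X. \<phi> i X \<cdot>\<^bsub>D\<^esub> \<theta> (HO U i X))"
    using coh_iso_via_push_cmp assms unfolding classifies_def induced_by_def by blast
  then show ?thesis using R unfolding classifies_def coh_iso_def induced_by_def by blast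
qed

text \<open>\<open>coh_iso_via\<close> reads only the fields of \<open>coh\<close>, on which
  \<open>rel_push\<close> and \<open>push\<close> agree. The absolute result thus applies over the
  category of pairs, and the boundary is left as a separate condition.\<close>

lemma coh_iso_via_rel_push:
  "coh_iso_via T B (rel_push A B F U) H \<phi> \<longleftrightarrow> coh_iso_via T B (push A B F U) H \<phi>"
  by (simp add: coh_iso_via_def)

lemma coh_iso_via_push_rel_push:
  "coh_iso_via T D (push B D R (rel_push A B F U)) H \<phi> \<longleftrightarrow>
   coh_iso_via T D (push B D R (push A B F U)) H \<phi>"
  by (simp add: coh_iso_via_def)

text \<open>The isomorphism of the underlying Kuenneth cohomologies also respects boundaries: for
  \<open>\<theta>\<close> this is naturality at the arrow \<open>Bd U n i j\<close> of
  \<open>A\<close>, for \<open>\<phi>\<close> it is part of the hypothesis on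
  \<open>F\<close>.\<close>

lemma rel_classifies_induced:
  assumes U: "relative_kunneth_cohomology C M un emp A U" and H: "relative_kunneth_cohomology C M un emp D H"
    and P: "exact_tensor_functor A B P" and F: "rel_classifies C M un emp A U D H F"
    and R: "induced_by A B D P F R"
  shows "rel_classifies C M un emp B (rel_push A B P U) D H R"
proof -
  let ?T = "pair_cat C M un emp"
  interpret U: relative_kunneth_cohomology C M un emp A U by fact
  interpret H: relative_kunneth_cohomology C M un emp D H by fact
  interpret P: exact_tensor_functor A B P by fact
  interpret R: exact_tensor_functor B D R using R by (simp add: induced_by_def)
  interpret F: exact_tensor_functor A D F using F by (simp add: rel_classifies_def)
  obtain \<theta> where \<theta>: "natural_iso A D (cmp_tfctr D R P) F \<theta>"
    "\<And>X Y. X \<in> Obj A \<Longrightarrow> Y \<in> Obj A \<Longrightarrow>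
        \<theta> (X \<odot>\<^bsub>A\<^esub> Y) \<cdot>\<^bsub>D\<^esub> FMu (cmp_tfctr D R P) X Y = FMu F X Y \<cdot>\<^bsub>D\<^esub> (\<theta> X \<otimes>\<^bsub>D\<^esub> \<theta> Y)"
    "\<theta> (Unit A) \<cdot>\<^bsub>D\<^esub> FEps (cmp_tfctr D R P) = FEps F"
    using R unfolding induced_by_def tensor_iso_def by blast
  obtain \<phi> where \<phi>: "coh_iso_via ?T D (push A D F U) H \<phi>"
    and bd: "\<And>n i j. i \<in> M \<Longrightarrow> j \<in> M \<Longrightarrow> Cod C j = Dom C i \<Longrightarrow>
      \<phi> (n + 1) i \<cdot>\<^bsub>D\<^esub> FA F (Bd U n i j) = Bd H n i j \<cdot>\<^bsub>D\<^esub> \<phi> n j"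
    using F unfolding rel_classifies_def rel_coh_iso_def coh_iso_via_rel_push rel_push_simps by blast
  let ?\<psi> = "\<lambda>i X. \<phi> i X \<cdot>\<^bsub>D\<^esub> \<theta> (HO U i X)"
  have \<psi>: "coh_iso_via ?T D (push B D R (push A B P U)) H ?\<psi>"
    using coh_iso_via_push_cmp[OF U.kunneth_cohomology_axioms H.kunneth_cohomology_axioms P
        R.exact_tensor_functor_axioms F.exact_tensor_functor_axioms \<theta> \<phi>] .
  have M: "Obj ?T = M" by (simp add: pair_cat_def Let_def)
  have t: "\<theta> X \<in> Hom D (FO R (FO P X)) (FO F X)" if "X \<in> Obj A" for X
    using \<theta>(1) that by (simp add: natural_iso_def cmp_tfctr_def)
  have p: "\<phi> i X \<in> Hom D (FO F (HO U i X)) (HO H i X)" if "X \<in> M" for i X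
    using \<phi> that M by (simp add: coh_iso_via_def)
  have "?\<psi> (n + 1) i \<cdot>\<^bsub>D\<^esub> FA R (FA P (Bd U n i j)) = Bd H n i j \<cdot>\<^bsub>D\<^esub> ?\<psi> n j"
    if i: "i \<in> M" and j: "j \<in> M" and c: "Cod C j = Dom C i" for n i j
  proof -
    note b = U.bd_in[OF i j c, of n]
    note o = U.A.Hom_objD[OF b]
    have n: "\<theta> (HO U (n + 1) i) \<cdot>\<^bsub>D\<^esub> FA R (FA P (Bd U n i j)) = FA F (Bd U n i j) \<cdot>\<^bsub>D\<^esub> \<theta> (HO U n j)"
      using \<theta>(1) b by (simp add: natural_iso_def cmp_tfctr_def)
    have "?\<psi> (n + 1) i \<cdot>\<^bsub>D\<^esub> FA R (FA P (Bd U n i j)) =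
        \<phi> (n + 1) i \<cdot>\<^bsub>D\<^esub> (FA F (Bd U n i j) \<cdot>\<^bsub>D\<^esub> \<theta> (HO U n j))"
      using H.A.cmp_assoc[OF R.fa_in[OF P.fa_in[OF b]] t[OF o(2)] p[OF i]] n by simp
    also have "\<dots> = (Bd H n i j \<cdot>\<^bsub>D\<^esub> \<phi> n j) \<cdot>\<^bsub>D\<^esub> \<theta> (HO U n j)"
      using H.A.cmp_assoc[OF t[OF o(1)] F.fa_in[OF b] p[OF i]] bd[OF i j c] by simp
    also have "\<dots> = Bd H n i j \<cdot>\<^bsub>D\<^esub> ?\<psi> n j"
      using H.A.cmp_assoc[OF t[OF o(1)] p[OF j] H.bd_in[OF i j c]] .
    finally show ?thesis .
  qed
  then have "rel_coh_iso C M un emp D (rel_push B D R (rel_push A B P U)) H"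
    unfolding rel_coh_iso_def coh_iso_via_rel_push coh_iso_via_push_rel_push rel_push_simps using \<psi> by blast
  then show ?thesis using R.exact_tensor_functor_axioms by (simp add: rel_classifies_def)
qed

text \<open>A member of \<open>S\<close> is a pair because each cohomology brings its own category
  of values. \<open>quo\<close> and \<open>prj\<close> fix one Serre quotient for each ideal, while
  \<open>r\<close> and \<open>can\<close> are any functors induced on it up to isomorphism, so the
  equivalences do not depend on how these are chosen.\<close>

theorem proposition2p2:
  fixes C :: "('c, 'd) tcat"
    and A :: "('o, 'm) lcat"
    and U :: "('c, 'd, 'o, 'm) coh"
    and quo :: "'o set \<Rightarrow> ('o, 'm) lcat"
    and prj :: "'o set \<Rightarrow> ('o, 'm, 'o, 'm) tfctr"
    and S :: "(('o, 'm) lcat \<times> ('c, 'd, 'o, 'm) coh) set"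
    and F r can :: "('o, 'm) lcat \<times> ('c, 'd, 'o, 'm) coh \<Rightarrow> ('o, 'm, 'o, 'm) tfctr"
    and C' :: "('a, 'b) tcat"
    and M :: "'b set" and un :: "'b \<Rightarrow> 'b \<Rightarrow> 'b" and emp :: "'a"
    and A' :: "('p, 'q) lcat"
    and U' :: "('b, 'b \<times> 'b \<times> 'b, 'p, 'q) rel_coh"
    and quo' :: "'p set \<Rightarrow> ('p, 'q) lcat"
    and prj' :: "'p set \<Rightarrow> ('p, 'q, 'p, 'q) tfctr"
    and S' :: "(('p, 'q) lcat \<times> ('b, 'b \<times> 'b \<times> 'b, 'p, 'q) rel_coh) set"
    and F' r' can' :: "('p, 'q) lcat \<times> ('b, 'b \<times> 'b \<times> 'b, 'p, 'q) rel_coh \<Rightarrow> ('p, 'q, 'p, 'q) tfctr"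
  shows "(cartesian_category C \<and>
       universal_kunneth C A U \<and>
       (\<forall>K. serre_tensor_ideal A K \<longrightarrow> is_serre_quotient A K (quo K) (prj K)) \<and>
       (\<forall>h \<in> S. kunneth_cohomology C (fst h) (snd h)) \<and>
       (\<forall>h \<in> S. classifies C A U (fst h) (snd h) (F h)) \<and>
       (\<forall>h \<in> S. induced_by A (quo (joint_Ker A S F)) (fst h) (prj (joint_Ker A S F)) (F h) (r h)) \<and>
       (\<forall>h \<in> S. induced_by A (quo (joint_Ker A S F)) (quo (Ker A (fst h) (F h)))
                   (prj (joint_Ker A S F)) (prj (Ker A (fst h) (F h))) (can h))
       \<longrightarrow>
       ((\<forall>h \<in> S. \<forall>k \<in> S. equivalent_under A
             (quo (Ker A (fst h) (F h))) (prj (Ker A (fst h) (F h)))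
             (quo (Ker A (fst k) (F k))) (prj (Ker A (fst k) (F k))))
        \<longleftrightarrow>
        (\<forall>h \<in> S. realisation C (quo (joint_Ker A S F))
             (push A (quo (joint_Ker A S F)) (prj (joint_Ker A S F)) U) (fst h) (snd h) (r h)))
       \<and>
       ((\<forall>h \<in> S. realisation C (quo (joint_Ker A S F))
             (push A (quo (joint_Ker A S F)) (prj (joint_Ker A S F)) U) (fst h) (snd h) (r h))
        \<longleftrightarrow>
        (\<forall>h \<in> S. equivalence (quo (joint_Ker A S F)) (quo (Ker A (fst h) (F h))) (can h))))
      \<and>
      (pair_category C' M un emp \<and>
       universal_relative_kunneth C' M un emp A' U' \<and>
       (\<forall>K. serre_tensor_ideal A' K \<longrightarrow> is_serre_quotient A' K (quo' K) (prj' K)) \<and>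
       (\<forall>h \<in> S'. relative_kunneth_cohomology C' M un emp (fst h) (snd h)) \<and>
       (\<forall>h \<in> S'. rel_classifies C' M un emp A' U' (fst h) (snd h) (F' h)) \<and>
       (\<forall>h \<in> S'. induced_by A' (quo' (joint_Ker A' S' F')) (fst h) (prj' (joint_Ker A' S' F')) (F' h) (r' h)) \<and>
       (\<forall>h \<in> S'. induced_by A' (quo' (joint_Ker A' S' F')) (quo' (Ker A' (fst h) (F' h)))
                   (prj' (joint_Ker A' S' F')) (prj' (Ker A' (fst h) (F' h))) (can' h))
       \<longrightarrow>
       ((\<forall>h \<in> S'. \<forall>k \<in> S'. equivalent_under A'
             (quo' (Ker A' (fst h) (F' h))) (prj' (Ker A' (fst h) (F' h)))
             (quo' (Ker A' (fst k) (F' k))) (prj' (Ker A' (fst k) (F' k))))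
        \<longleftrightarrow>
        (\<forall>h \<in> S'. rel_realisation C' M un emp (quo' (joint_Ker A' S' F'))
             (rel_push A' (quo' (joint_Ker A' S' F')) (prj' (joint_Ker A' S' F')) U') (fst h) (snd h) (r' h)))
       \<and>
       ((\<forall>h \<in> S'. rel_realisation C' M un emp (quo' (joint_Ker A' S' F'))
             (rel_push A' (quo' (joint_Ker A' S' F')) (prj' (joint_Ker A' S' F')) U') (fst h) (snd h) (r' h))
        \<longleftrightarrow>
        (\<forall>h \<in> S'. equivalence (quo' (joint_Ker A' S' F')) (quo' (Ker A' (fst h) (F' h))) (can' h))))"
proof (rule conjI; rule impI; (elim conjE)?)
  assume U: "universal_kunneth C A U"
    and quo: "\<forall>K. serre_tensor_ideal A K \<longrightarrow> is_serre_quotient A K (quo K) (prj K)"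
    and H: "\<forall>h \<in> S. kunneth_cohomology C (fst h) (snd h)"
    and F: "\<forall>h \<in> S. classifies C A U (fst h) (snd h) (F h)"
    and r: "\<forall>h \<in> S. induced_by A (quo (joint_Ker A S F)) (fst h) (prj (joint_Ker A S F)) (F h) (r h)"
    and can: "\<forall>h \<in> S. induced_by A (quo (joint_Ker A S F)) (quo (Ker A (fst h) (F h)))
                   (prj (joint_Ker A S F)) (prj (Ker A (fst h) (F h))) (can h)"
  have UK: "kunneth_cohomology C A U" using U by (simp add: universal_kunneth_def)
  let ?K = "joint_Ker A S F"
  have F': "exact_tensor_functor A (fst h) (F h)" if "h \<in> S" for h
    using F that by (simp add: classifies_def)
  note crit = serre_quotient_criterion[OF quo[rule_format] F' r[rule_format] can[rule_format]]
  have "classifies C (quo ?K) (push A (quo ?K) (prj ?K) U) (fst h) (snd h) (r h)" if h: "h \<in> S" for h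
  proof -
    have "is_serre_quotient A ?K (quo ?K) (prj ?K)"
      using joint_Ker_serre_tensor_ideal[OF _ F'] h quo by blast
    note P = serre_quotientD(2)[OF this]
    show ?thesis
      using classifies_induced[OF UK H[rule_format, OF h] P F[rule_format, OF h] r[rule_format, OF h]] .
  qed
  \<comment> \<open>With the push-forward statement established for every \<open>h\<close>, being a
    realisation amounts to faithfulness of \<open>r h\<close>.\<close>
  then have "(\<forall>h \<in> S. realisation C (quo ?K) (push A (quo ?K) (prj ?K) U) (fst h) (snd h) (r h)) \<longleftrightarrow>
      (\<forall>h \<in> S. faithful (quo ?K) (r h))"
    unfolding realisation_def by blast
  then show "((\<forall>h \<in> S. \<forall>k \<in> S. equivalent_under A
             (quo (Ker A (fst h) (F h))) (prj (Ker A (fst h) (F h)))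
             (quo (Ker A (fst k) (F k))) (prj (Ker A (fst k) (F k))))
        \<longleftrightarrow>
        (\<forall>h \<in> S. realisation C (quo (joint_Ker A S F))
             (push A (quo (joint_Ker A S F)) (prj (joint_Ker A S F)) U) (fst h) (snd h) (r h)))
       \<and>
       ((\<forall>h \<in> S. realisation C (quo (joint_Ker A S F))
             (push A (quo (joint_Ker A S F)) (prj (joint_Ker A S F)) U) (fst h) (snd h) (r h))
        \<longleftrightarrow>
        (\<forall>h \<in> S. equivalence (quo (joint_Ker A S F)) (quo (Ker A (fst h) (F h))) (can h)))"
    using crit by blast
next
  assume U: "universal_relative_kunneth C' M un emp A' U'"
    and quo: "\<forall>K. serre_tensor_ideal A' K \<longrightarrow> is_serre_quotient A' K (quo' K) (prj' K)"
    and H: "\<forall>h \<in> S'. relative_kunneth_cohomology C' M un emp (fst h) (snd h)"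
    and F: "\<forall>h \<in> S'. rel_classifies C' M un emp A' U' (fst h) (snd h) (F' h)"
    and r: "\<forall>h \<in> S'. induced_by A' (quo' (joint_Ker A' S' F')) (fst h) (prj' (joint_Ker A' S' F')) (F' h) (r' h)"
    and can: "\<forall>h \<in> S'. induced_by A' (quo' (joint_Ker A' S' F')) (quo' (Ker A' (fst h) (F' h)))
                   (prj' (joint_Ker A' S' F')) (prj' (Ker A' (fst h) (F' h))) (can' h)"
  have UK: "relative_kunneth_cohomology C' M un emp A' U'" using U by (simp add: universal_relative_kunneth_def)
  let ?K = "joint_Ker A' S' F'"
  have F': "exact_tensor_functor A' (fst h) (F' h)" if "h \<in> S'" for h
    using F that by (simp add: rel_classifies_def)
  note crit = serre_quotient_criterion[OF quo[rule_format] F' r[rule_format] can[rule_format]]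
  have "rel_classifies C' M un emp (quo' ?K) (rel_push A' (quo' ?K) (prj' ?K) U') (fst h) (snd h) (r' h)"
    if h: "h \<in> S'" for h
  proof -
    have "is_serre_quotient A' ?K (quo' ?K) (prj' ?K)"
      using joint_Ker_serre_tensor_ideal[OF _ F'] h quo by blast
    note P = serre_quotientD(2)[OF this]
    show ?thesis
      using rel_classifies_induced[OF UK H[rule_format, OF h] P F[rule_format, OF h] r[rule_format, OF h]] .
  qed
  \<comment> \<open>The same reduction, with compatibility with the boundary now contained in
    \<open>rel_classifies\<close>.\<close>
  then have "(\<forall>h \<in> S'. rel_realisation C' M un emp (quo' ?K) (rel_push A' (quo' ?K) (prj' ?K) U') (fst h) (snd h) (r' h)) \<longleftrightarrow>
      (\<forall>h \<in> S'. faithful (quo' ?K) (r' h))"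
    unfolding rel_realisation_def by blast
  then show "((\<forall>h \<in> S'. \<forall>k \<in> S'. equivalent_under A'
             (quo' (Ker A' (fst h) (F' h))) (prj' (Ker A' (fst h) (F' h)))
             (quo' (Ker A' (fst k) (F' k))) (prj' (Ker A' (fst k) (F' k))))
        \<longleftrightarrow>
        (\<forall>h \<in> S'. rel_realisation C' M un emp (quo' (joint_Ker A' S' F'))
             (rel_push A' (quo' (joint_Ker A' S' F')) (prj' (joint_Ker A' S' F')) U') (fst h) (snd h) (r' h)))
       \<and>
       ((\<forall>h \<in> S'. rel_realisation C' M un emp (quo' (joint_Ker A' S' F'))
             (rel_push A' (quo' (joint_Ker A' S' F')) (prj' (joint_Ker A' S' F')) U') (fst h) (snd h) (r' h))
        \<longleftrightarrow>
        (\<forall>h \<in> S'. equivalence (quo' (joint_Ker A' S' F')) (quo' (Ker A' (fst h) (F' h))) (can' h)))"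
    using crit by blast
qed

end
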